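(* Let $i\ge0$, let $K$ be a finite abstract simplicial complex and let $\Sigma$ be an $i$-motif of $K$ consisting of a single vertex which is the center of neither an orientable $(i+1)$-circuit of odd length nor a non-orientable $(i+1)$-circuit of even length in $K$. Then the complex $K^\Sigma$ obtained from $K$ by duplicating $\Sigma$ has the eigenvalue $i+1$ in the spectrum of $\Delta_i^{up}(K^\Sigma)$.
   Context: For a finite abstract simplicial complex $K$ (closed under inclusion, containing the empty face), $S_i(K)$ is the set of $i$-faces and $C^i(K,\mathbb{R})$ is the space of real functions on oriented $i$-faces that change sign when the orientation is reversed. The coboundary $\delta_i:C^i\to C^{i+1}$ is $(\delta_i f)([v_0,\dots,v_{i+1}])=\sum_{j}(-1)^j f([v_0,\dots,\hat v_j,\dots,v_{i+1}])$. A positive weight function $w$ on faces defines inner products $(f,g)_{C^i}=\sum_{F\in S_i(K)}w(F)f([F])g([F])$, with adjoint $\delta_i^*$. The degree of an $i$-face is $\deg F=\sum_{\bar F\in S_{i+1}(K),\,F\subset\bar F}w(\bar F)$. The normalized combinatorial Laplacian is $\Delta_i^{up}(K)=\delta_i^*\delta_i$ on $C^i(K,\mathbb{R})$ for the weight function with $w(F)=1$ for every facet (inclusion-maximal face) and $w(F)=\deg F$ for every other face. An $(i+1)$-circuit of length $m\ge3$ in $K$ is a pure $(i+1)$-dimensional subcomplex whose distinct $(i+1)$-faces can be listed cyclically as $F_1,\dots,F_m$ so that two distinct $F_j,F_l$ intersect in an $i$-face if and only if $j,l$ are cyclically consecutive ($j-l\equiv\pm1\bmod m$). Its centers are the vertices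 in $\bigcap_{j}F_j$. A pure $(i+1)$-dimensional complex is orientable if its $(i+1)$-faces can be oriented so that any two that intersect in an $i$-face induce different (opposite) orientations on that face. For a collection $S$ of nonempty simplices of $K$: $\operatorname{Cl}S$ is the smallest subcomplex containing $S$; $\operatorname{St}S$ is the set of simplices of $K$ having a (nonempty) face in $S$; $\operatorname{lk}S=\operatorname{Cl}\operatorname{St}S-\operatorname{St}\operatorname{Cl}S$. A single vertex $\Sigma=\{v\}$ is an $i$-motif if $\dim\operatorname{lk}\Sigma=i$. Duplicating $\Sigma=\{v\}$ means adding a new vertex $v'$ and forming $K^\Sigma=K\cup\{\{v',u_{1},\dots,u_{s}\}\mid\{v,u_{1},\dots,u_{s}\}\in K\}$. *)

theory Defs
  imports Complex_Main "HOL-Combinatorics.Permutations"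
begin

section \<open>Finite abstract simplicial complexes\<close>

definition simplicial_complex :: "'a set set \<Rightarrow> bool" where
  "simplicial_complex K \<longleftrightarrow>
     finite K \<and> (\<forall>F\<in>K. finite F) \<and> {} \<in> K \<and> (\<forall>F\<in>K. \<forall>G\<subseteq>F. G \<in> K)"

definition subcomplex :: "'a set set \<Rightarrow> 'a set set \<Rightarrow> bool" where
  "subcomplex L K \<longleftrightarrow> simplicial_complex L \<and> L \<subseteq> K"

text \<open>The \<open>i\<close>-faces, written \<open>S\<^sub>i(K)\<close>; an \<open>i\<close>-face has \<open>i + 1\<close> vertices.\<close>
definition faces :: "'a set set \<Rightarrow> nat \<Rightarrow> 'a set set" where
  "faces K i = {F \<in> K. card F = Suc i}"

definition facet :: "'a set set \<Rightarrow> 'a set \<Rightarrow> bool" where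
  "facet K F \<longleftrightarrow> F \<in> K \<and> (\<forall>G\<in>K. F \<subseteq> G \<longrightarrow> G = F)"

definition pure :: "'a set set \<Rightarrow> nat \<Rightarrow> bool" where
  "pure K d \<longleftrightarrow> (\<forall>F. facet K F \<longrightarrow> F \<in> faces K d)"

text \<open>Dimension of a nonempty finite collection of simplices, with \<open>dim {} = -1\<close>
  for the empty simplex.\<close>
definition complex_dim :: "'a set set \<Rightarrow> int" where
  "complex_dim S = Max ((\<lambda>F. int (card F) - 1) ` S)"


section \<open>Cochains and the normalized up-Laplacian\<close>

text \<open>Oriented simplices are written as lists \<open>[v\<^sub>0, \<dots>, v\<^sub>i]\<close> of distinct vertices. A cochain is
  an alternating function of such lists: even permutations leave the orientation unchanged, odd
  ones reverse it. Cochains are set to \<open>0\<close> off the oriented \<open>i\<close>-faces of \<open>K\<close>, so that equality of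
  cochains is equality of functions.\<close>

definition orderings :: "'a set set \<Rightarrow> nat \<Rightarrow> 'a list set" where
  "orderings K i = {xs. distinct xs \<and> set xs \<in> faces K i}"

definition cochains :: "'a set set \<Rightarrow> nat \<Rightarrow> ('a list \<Rightarrow> real) set" where
  "cochains K i = {f.
     (\<forall>xs\<in>orderings K i. \<forall>p. p permutes {..<length xs} \<longrightarrow>
        f (permute_list p xs) = of_int (sign p) * f xs) \<and>
     (\<forall>xs. xs \<notin> orderings K i \<longrightarrow> f xs = 0)}"

definition remove_nth :: "nat \<Rightarrow> 'a list \<Rightarrow> 'a list" where
  "remove_nth j xs = take j xs @ drop (Suc j) xs"

definition coboundary ::
    "'a set set \<Rightarrow> nat \<Rightarrow> ('a list \<Rightarrow> real) \<Rightarrow> 'a list \<Rightarrow> real" where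
  "coboundary K i f xs =
     (if xs \<in> orderings K (Suc i)
      then \<Sum>j<length xs. (-1) ^ j * f (remove_nth j xs) else 0)"

definition some_ordering :: "'a set \<Rightarrow> 'a list" where
  "some_ordering F = (SOME xs. distinct xs \<and> set xs = F)"

text \<open>The product \<open>f([F]) g([F])\<close> does not depend on the orientation chosen for \<open>F\<close>.\<close>
definition cochain_inner ::
    "'a set set \<Rightarrow> ('a set \<Rightarrow> real) \<Rightarrow> nat \<Rightarrow> ('a list \<Rightarrow> real) \<Rightarrow> ('a list \<Rightarrow> real) \<Rightarrow> real" where
  "cochain_inner K w i f g =
     (\<Sum>F\<in>faces K i. w F * f (some_ordering F) * g (some_ordering F))"

definition coboundary_adjoint ::
    "'a set set \<Rightarrow> ('a set \<Rightarrow> real) \<Rightarrow> nat \<Rightarrow> ('a list \<Rightarrow> real) \<Rightarrow> 'a list \<Rightarrow> real" where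
  "coboundary_adjoint K w i g = (THE h. h \<in> cochains K i \<and>
     (\<forall>f\<in>cochains K i.
        cochain_inner K w (Suc i) (coboundary K i f) g = cochain_inner K w i f h))"

definition up_laplacian ::
    "'a set set \<Rightarrow> ('a set \<Rightarrow> real) \<Rightarrow> nat \<Rightarrow> ('a list \<Rightarrow> real) \<Rightarrow> 'a list \<Rightarrow> real" where
  "up_laplacian K w i f = coboundary_adjoint K w i (coboundary K i f)"

text \<open>The weight function with \<open>w(F) = 1\<close> on facets and \<open>w(F) = deg F\<close> on all other faces. Since
  \<open>deg F\<close> is the sum of the weights of the faces of one dimension higher that contain \<open>F\<close>, this is
  a recursion downwards from the facets; the values for infinite \<open>K\<close> or \<open>F \<notin> K\<close> are irrelevant.\<close>
function normalized_weight :: "'a set set \<Rightarrow> 'a set \<Rightarrow> real" where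
  "normalized_weight K F =
     (if finite K \<and> F \<in> K \<and> \<not> facet K F
      then \<Sum>G\<in>{G \<in> K. F \<subset> G \<and> card G = Suc (card F)}. normalized_weight K G
      else 1)"
  by pat_completeness auto
termination
proof (relation "measure (\<lambda>(K, F). card {G \<in> K. F \<subset> G})", goal_cases)
  case 1
  show ?case by simp
next
  case (2 K F G)
  then have "{H \<in> K. G \<subset> H} \<subset> {H \<in> K. F \<subset> H}" by auto
  with 2 show ?case by (auto intro!: psubset_card_mono)
qed

declare normalized_weight.simps [simp del]

definition normalized_up_laplacian ::
    "'a set set \<Rightarrow> nat \<Rightarrow> ('a list \<Rightarrow> real) \<Rightarrow> 'a list \<Rightarrow> real" where
  "normalized_up_laplacian K i = up_laplacian K (normalized_weight K) i"

text \<open>The operator acts on a finite-dimensional space and is self-adjoint, so its spectrum is the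
  set of its real eigenvalues.\<close>
definition up_spectrum :: "'a set set \<Rightarrow> nat \<Rightarrow> real set" where
  "up_spectrum K i = {c. \<exists>f\<in>cochains K i. f \<noteq> (\<lambda>_. 0) \<and>
     normalized_up_laplacian K i f = (\<lambda>xs. c * f xs)}"


section \<open>Circuits and orientability\<close>

text \<open>\<open>circuit K i L m\<close>: \<open>L\<close> is an \<open>(i+1)\<close>-circuit of length \<open>m\<close> in \<open>K\<close>. The cyclic list is indexed
  by \<open>0, \<dots>, m - 1\<close>.\<close>
definition circuit :: "'a set set \<Rightarrow> nat \<Rightarrow> 'a set set \<Rightarrow> nat \<Rightarrow> bool" where
  "circuit K i L m \<longleftrightarrow> 3 \<le> m \<and> subcomplex L K \<and> pure L (Suc i) \<and>
     (\<exists>F. bij_betw F {..<m} (faces L (Suc i)) \<and>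
        (\<forall>j<m. \<forall>l<m. j \<noteq> l \<longrightarrow>
           (F j \<inter> F l \<in> faces L i \<longleftrightarrow> Suc j mod m = l \<or> Suc l mod m = j)))"

definition circuit_centers :: "nat \<Rightarrow> 'a set set \<Rightarrow> 'a set" where
  "circuit_centers i L = \<Inter> (faces L (Suc i))"

text \<open>The orientation that \<open>[v\<^sub>0, \<dots>, v\<^sub>d]\<close> induces on its codimension-one face \<open>H\<close> omitting \<open>v\<^sub>j\<close>
  is \<open>(-1)\<^sup>j [v\<^sub>0, \<dots>, v\<^sub>j\<^sub>-\<^sub>1, v\<^sub>j\<^sub>+\<^sub>1, \<dots>, v\<^sub>d]\<close>. It is represented by the class of all signed orderings
  of \<open>H\<close> equivalent to this one; the explicit sign is what gives a single vertex its two
  orientations.\<close>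
definition induced_orientation :: "'a list \<Rightarrow> 'a set \<Rightarrow> (int \<times> 'a list) set" where
  "induced_orientation xs H =
     {((-1) ^ j * sign p, permute_list p (remove_nth j xs)) | j p.
        j < length xs \<and> set (remove_nth j xs) = H \<and> p permutes {..<length (remove_nth j xs)}}"

text \<open>Orientability of a pure \<open>(i+1)\<close>-dimensional complex \<open>L\<close>; \<open>ori F\<close> is an ordering of \<open>F\<close>.
  As \<open>i + 1 \<ge> 1\<close>, both orientations of \<open>F\<close> are given by orderings without a sign.\<close>
definition orientable :: "nat \<Rightarrow> 'a set set \<Rightarrow> bool" where
  "orientable i L \<longleftrightarrow> (\<exists>ori :: 'a set \<Rightarrow> 'a list.
     (\<forall>F\<in>faces L (Suc i). distinct (ori F) \<and> set (ori F) = F) \<and>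
     (\<forall>F\<in>faces L (Suc i). \<forall>G\<in>faces L (Suc i). F \<noteq> G \<and> F \<inter> G \<in> faces L i \<longrightarrow>
        induced_orientation (ori F) (F \<inter> G) \<noteq> induced_orientation (ori G) (F \<inter> G)))"


section \<open>Links, motifs and duplication\<close>

definition closure_of_simplices :: "'a set set \<Rightarrow> 'a set set \<Rightarrow> 'a set set" where
  "closure_of_simplices K S = \<Inter> {L. subcomplex L K \<and> S \<subseteq> L}"

definition star :: "'a set set \<Rightarrow> 'a set set \<Rightarrow> 'a set set" where
  "star K S = {F \<in> K. \<exists>G\<in>S. G \<noteq> {} \<and> G \<subseteq> F}"

definition link :: "'a set set \<Rightarrow> 'a set set \<Rightarrow> 'a set set" where
  "link K S = closure_of_simplices K (star K S) - star K (closure_of_simplices K S)"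

definition vertex_motif :: "'a set set \<Rightarrow> nat \<Rightarrow> 'a \<Rightarrow> bool" where
  "vertex_motif K i v \<longleftrightarrow> {v} \<in> K \<and> complex_dim (link K {{v}}) = int i"

definition duplicate_vertex :: "'a set set \<Rightarrow> 'a \<Rightarrow> 'a \<Rightarrow> 'a set set" where
  "duplicate_vertex K v v' = K \<union> {insert v' U | U. v \<notin> U \<and> insert v U \<in> K}"

end

theory Submission imports Defs begin

text \<open>The \<open>(i+1)\<close>-faces containing \<open>v\<close>, joined when they share an \<open>i\<close>-face, form a graph whose edges
  carry a sign recording whether two reference orientations agree on the common \<open>i\<close>-face. Its induced
  cycles are the circuits centered at \<open>v\<close>, and the hypothesis on circuits says exactly that each of
  them has sign \<open>1\<close>. Hence the graph is balanced: the faces can be oriented so that neighbours always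
  induce the same orientation. Let the cochain \<open>H\<close> be \<open>1\<close> on these oriented faces, \<open>-1\<close> on their
  copies at \<open>v'\<close>, and \<open>0\<close> elsewhere. Since all faces involved are facets of weight \<open>1\<close>, the value of
  \<open>\<delta>\<^sup>* H\<close> on an \<open>i\<close>-face containing \<open>v\<close> or \<open>v'\<close> is an average of equal values of \<open>H\<close>, while on all other
  faces the contributions of \<open>v\<close> and \<open>v'\<close> cancel. Therefore \<open>\<delta> \<delta>\<^sup>* H = (i+1) H\<close>, and \<open>\<delta>\<^sup>* H\<close> is the
  required eigenfunction.\<close>

section \<open>Alternating functions of lists\<close>

text \<open>Quantifying over all distinct lists, not only the orderings in one complex, lets the
  same sign rules serve cochains of \<open>K\<close> and of the duplicated complex as well as
  \<open>ordering_sign\<close>.\<close>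

definition alternating :: "('a list \<Rightarrow> real) \<Rightarrow> bool" where
  "alternating f \<longleftrightarrow> (\<forall>xs p. distinct xs \<longrightarrow> p permutes {..<length xs} \<longrightarrow>
     f (permute_list p xs) = of_int (sign p) * f xs)"

lemma alternating_permute:
  "alternating f \<Longrightarrow> distinct xs \<Longrightarrow> p permutes {..<length xs} \<Longrightarrow>
    f (permute_list p xs) = of_int (sign p) * f xs"
  by (simp add: alternating_def)

lemma obtain_permutation:
  assumes "distinct xs" "distinct ys" "set xs = set ys"
  obtains p where "p permutes {..<length xs}" "permute_list p xs = ys"
  using assms mset_eq_permutation[of ys xs] by (metis set_eq_iff_mset_eq_distinct)

lemma permute_list_inj:
  assumes "distinct xs" "p permutes {..<length xs}" "q permutes {..<length xs}"
    and "permute_list p xs = permute_list q xs"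
  shows "p = q"
proof
  fix k
  show "p k = q k"
  proof (cases "k < length xs")
    case True
    then have "xs ! p k = xs ! q k"
      using assms by (metis permute_list_nth)
    moreover have "p k < length xs" "q k < length xs"
      using True assms permutes_in_image by fastforce+
    ultimately show ?thesis
      using assms(1) nth_eq_iff_index_eq by blast
  next
    case False
    then show ?thesis
      using assms(2,3) by (simp add: permutes_not_in)
  qed
qed

text \<open>\<open>p\<close> is transported along \<open>Suc\<close> to the positions behind the
  head: position \<open>0\<close> stays fixed and the sign is kept.\<close>

lemma permute_list_Cons_shift:
  assumes "p permutes {..<length xs}"
  obtains q where "q permutes {..<length (a # xs)}" "sign q = sign p"
    "permute_list q (a # xs) = a # permute_list p xs"
proof
  let ?q = "map_permutation {..<length xs} Suc p"
  have img: "Suc ` {..<length xs} = {1..<Suc (length xs)}"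
    by (simp add: lessThan_atLeast0)
  have q: "?q permutes {1..<Suc (length xs)}"
    by (rule map_permutation_permutes[OF _ assms]) (auto simp: bij_betw_def img)
  then show "?q permutes {..<length (a # xs)}"
    by (rule permutes_subset) auto
  show "sign ?q = sign p"
    using assms by (intro sign_map_permutation) auto
  have "?q 0 = 0"
    using q by (simp add: permutes_not_in)
  moreover have "?q (Suc k) = Suc (p k)" if "k < length xs" for k
    using that by (simp add: map_permutation_apply)
  ultimately show "permute_list ?q (a # xs) = a # permute_list p xs"
    unfolding permute_list_def by (simp del: upt_Suc add: upt_conv_Cons flip: map_Suc_upt)
qed

lemma alternating_Cons_permute:
  assumes "alternating f" "distinct (a # xs)" "p permutes {..<length xs}"
  shows "f (a # permute_list p xs) = of_int (sign p) * f (a # xs)"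
  using assms by (metis alternating_permute permute_list_Cons_shift)

text \<open>The sign of the reordering enters both factors and squares to \<open>1\<close>. The two
  variants below put further vertices in front, where permuting the tail produces the same
  sign.\<close>

lemma alternating_mult_eq:
  assumes "alternating f" "alternating g" "distinct xs" "distinct ys" "set xs = set ys"
  shows "f xs * g xs = f ys * g ys"
proof -
  obtain p where p: "p permutes {..<length xs}" "permute_list p xs = ys"
    using assms obtain_permutation by metis
  have "f ys * g ys = (of_int (sign p) * of_int (sign p)) * (f xs * g xs)"
    using assms p alternating_permute[of _ xs p] by (auto simp: mult_ac)
  also have "(of_int (sign p) * of_int (sign p) :: real) = 1"
    by (simp flip: of_int_mult)
  finally show ?thesis by simp
qed

lemma alternating_mult_Cons_eq:
  assumes "alternating f" "alternating g" "distinct xs" "distinct ys" "set xs = set ys"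
    and "a \<notin> set xs"
  shows "f xs * g (a # xs) = f ys * g (a # ys)"
proof -
  obtain p where p: "p permutes {..<length xs}" "permute_list p xs = ys"
    using assms obtain_permutation by metis
  have "f ys * g (a # ys) = (of_int (sign p) * of_int (sign p)) * (f xs * g (a # xs))"
    using assms p alternating_permute[of f xs p] alternating_Cons_permute[of g a xs p]
    by (auto simp: mult_ac)
  also have "(of_int (sign p) * of_int (sign p) :: real) = 1"
    by (simp flip: of_int_mult)
  finally show ?thesis by simp
qed

lemma alternating_Cons_mult_Cons_eq:
  assumes "alternating f" "alternating g" "distinct xs" "distinct ys" "set xs = set ys"
    and "a \<notin> set xs" "b \<notin> set xs"
  shows "f (a # xs) * g (b # xs) = f (a # ys) * g (b # ys)"
proof -
  obtain p where p: "p permutes {..<length xs}" "permute_list p xs = ys"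
    using assms obtain_permutation by metis
  have "f (a # ys) * g (b # ys) = (of_int (sign p) * of_int (sign p)) * (f (a # xs) * g (b # xs))"
    using assms p alternating_Cons_permute[of f a xs p] alternating_Cons_permute[of g b xs p]
    by (auto simp: mult_ac)
  also have "(of_int (sign p) * of_int (sign p) :: real) = 1"
    by (simp flip: of_int_mult)
  finally show ?thesis by simp
qed

lemma alternating_swap:
  assumes "alternating f" "distinct (xs @ a # b # ys)"
  shows "f (xs @ b # a # ys) = - f (xs @ a # b # ys)"
proof -
  let ?n = "length xs" and ?zs = "xs @ a # b # ys"
  let ?p = "transpose ?n (Suc ?n)"
  have p: "?p permutes {..<length ?zs}"
    by (intro permutes_swap_id) auto
  have "permute_list ?p ?zs = xs @ b # a # ys"
  proof (rule nth_equalityI)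
    fix k assume "k < length (permute_list ?p ?zs)"
    then show "permute_list ?p ?zs ! k = (xs @ b # a # ys) ! k"
      using p by (auto simp: permute_list_nth nth_append nth_Cons' transpose_def)
  qed simp
  then show ?thesis
    using alternating_permute[OF assms p] by (simp add: sign_swap_id)
qed

text \<open>One adjacent swap for each entry that \<open>a\<close> passes. The induction peels
  \<open>xs\<close> from the right, since \<open>a\<close> passes its last entry first.\<close>

lemma alternating_move:
  assumes "alternating f" "distinct (xs @ a # ys)"
  shows "f (a # xs @ ys) = (-1) ^ length xs * f (xs @ a # ys)"
  using assms(2)
proof (induction xs arbitrary: ys rule: rev_induct)
  case (snoc b xs)
  have "f (a # xs @ b # ys) = (-1) ^ length xs * f (xs @ a # b # ys)"
    using snoc.prems by (intro snoc.IH) auto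
  also have "f (xs @ a # b # ys) = - f (xs @ b # a # ys)"
    using snoc.prems assms(1) by (intro alternating_swap) auto
  finally show ?case by simp
qed simp

section \<open>Deleting one vertex of an ordering\<close>

lemma set_remove_nth:
  assumes "distinct ys" "j < length ys"
  shows "set (remove_nth j ys) = set ys - {ys ! j}" "distinct (remove_nth j ys)"
    "ys ! j \<notin> set (remove_nth j ys)" "insert (ys ! j) (set (remove_nth j ys)) = set ys"
proof -
  have "ys = take j ys @ ys ! j # drop (Suc j) ys"
    using assms(2) by (rule id_take_nth_drop)
  then have "distinct (take j ys @ ys ! j # drop (Suc j) ys)"
    "set ys = set (take j ys @ ys ! j # drop (Suc j) ys)"
    using assms(1) by metis+
  then show "set (remove_nth j ys) = set ys - {ys ! j}" "distinct (remove_nth j ys)"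
    "ys ! j \<notin> set (remove_nth j ys)" "insert (ys ! j) (set (remove_nth j ys)) = set ys"
    by (auto simp: remove_nth_def)
qed

text \<open>Absorbs the sign \<open>(-1) ^ j\<close> of the coboundary formula: the deleted vertex
  is carried to the front.\<close>

lemma alternating_remove_nth:
  assumes "alternating f" "distinct ys" "j < length ys"
  shows "f (ys ! j # remove_nth j ys) = (-1) ^ j * f ys"
proof -
  have "ys = take j ys @ ys ! j # drop (Suc j) ys"
    using assms(3) by (rule id_take_nth_drop)
  then show ?thesis
    using alternating_move[OF assms(1), of "take j ys" "ys ! j" "drop (Suc j) ys"] assms(2,3)
    by (simp add: remove_nth_def)
qed

section \<open>Reference orderings and orientation signs\<close>

lemma some_ordering:
  assumes "finite F"
  shows "distinct (some_ordering F)" "set (some_ordering F) = F"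
    "length (some_ordering F) = card F"
proof -
  have "distinct (some_ordering F) \<and> set (some_ordering F) = F"
    unfolding some_ordering_def using finite_distinct_list[OF assms]
    by (intro someI_ex[of "\<lambda>xs. distinct xs \<and> set xs = F"]) blast
  then show "distinct (some_ordering F)" "set (some_ordering F) = F"
    "length (some_ordering F) = card F"
    using distinct_card by force+
qed

text \<open>With \<open>some_ordering\<close> as the reference orientation of each finite set,
  choosing an orientation of a face becomes choosing a real sign.\<close>

definition ordering_sign :: "'a list \<Rightarrow> real" where
  "ordering_sign ys = of_int (sign (SOME p. p permutes {..<length ys} \<and>
     permute_list p (some_ordering (set ys)) = ys))"

lemma ordering_sign_eq:
  assumes "distinct ys" "p permutes {..<length ys}"
    "permute_list p (some_ordering (set ys)) = ys"
  shows "ordering_sign ys = of_int (sign p)"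
proof -
  have "(SOME p. p permutes {..<length ys} \<and> permute_list p (some_ordering (set ys)) = ys) = p"
  proof (rule some_equality)
    fix q assume "q permutes {..<length ys} \<and> permute_list q (some_ordering (set ys)) = ys"
    then show "q = p"
      using assms permute_list_inj[of "some_ordering (set ys)" q p] some_ordering[of "set ys"]
      by (simp add: distinct_card)
  qed (use assms in simp)
  then show ?thesis by (simp add: ordering_sign_def)
qed

text \<open>Holds on all lists, because \<open>sign\<close> takes only the values \<open>1\<close>
  and \<open>-1\<close> whatever the choice operator returns.\<close>

lemma ordering_sign_square [simp]: "ordering_sign ys * ordering_sign ys = 1"
  by (simp add: ordering_sign_def flip: of_int_mult)

lemma alternating_ordering_sign: "alternating ordering_sign"
  unfolding alternating_def
proof (intro allI impI)
  fix xs :: "'a list" and q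
  assume xs: "distinct xs" and q: "q permutes {..<length xs}"
  let ?o = "some_ordering (set xs)"
  have o: "distinct ?o" "set ?o = set xs" "length ?o = length xs"
    using some_ordering[of "set xs"] xs by (auto simp: distinct_card)
  obtain p where p: "p permutes {..<length xs}" "permute_list p ?o = xs"
    using obtain_permutation[of ?o xs] o xs by auto
  have "permute_list (p \<circ> q) ?o = permute_list q xs"
    using q p o by (simp add: permute_list_compose)
  then have "ordering_sign (permute_list q xs) = of_int (sign (p \<circ> q))"
    using xs p q by (intro ordering_sign_eq) (auto intro: permutes_compose)
  also have "sign (p \<circ> q) = sign q * sign p"
    using p q by (subst sign_compose) (auto simp: permutation_permutes)
  finally show "ordering_sign (permute_list q xs) = of_int (sign q) * ordering_sign xs"
    using ordering_sign_eq[OF xs p] by simp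
qed

section \<open>Balanced signed graphs\<close>

text \<open>The equivalence rules out chords as well as missing edges, matching the cyclic condition
  in \<open>circuit\<close>.\<close>

definition induced_cycle :: "('b \<Rightarrow> 'b \<Rightarrow> bool) \<Rightarrow> nat \<Rightarrow> (nat \<Rightarrow> 'b) \<Rightarrow> bool" where
  "induced_cycle adj m c \<longleftrightarrow> 3 \<le> m \<and> inj_on c {..<m} \<and>
     (\<forall>j<m. \<forall>l<m. j \<noteq> l \<longrightarrow> (adj (c j) (c l) \<longleftrightarrow> Suc j mod m = l \<or> Suc l mod m = j))"

section \<open>Products of signs along paths and cycles\<close>

lemma prod_telescope_sign:
  fixes \<epsilon> :: "nat \<Rightarrow> real"
  assumes "\<And>k. k \<le> n \<Longrightarrow> \<epsilon> k * \<epsilon> k = 1"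
  shows "(\<Prod>k<n. \<epsilon> k * \<epsilon> (Suc k)) = \<epsilon> 0 * \<epsilon> n"
  using assms
proof (induction n)
  case 0
  then show ?case by simp
next
  case (Suc n)
  have "(\<Prod>k<Suc n. \<epsilon> k * \<epsilon> (Suc k)) = \<epsilon> 0 * (\<epsilon> n * \<epsilon> n) * \<epsilon> (Suc n)"
    using Suc by (simp add: mult_ac)
  then show ?case using Suc.prems[of n] by simp
qed

lemma prod_cyclic_split:
  fixes f :: "nat \<Rightarrow> nat \<Rightarrow> real"
  shows "(\<Prod>j<Suc n. f j (Suc j mod Suc n)) = (\<Prod>j<n. f j (Suc j)) * f n 0"
proof -
  have "(\<Prod>j<n. f j (Suc j mod Suc n)) = (\<Prod>j<n. f j (Suc j))"
    by (rule prod.cong) auto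
  then show ?thesis by simp
qed

text \<open>Each sign occurs in two neighbouring factors. This is the necessity half of the
  criterion for realizing edge signs on a cycle by vertex signs.\<close>

lemma prod_cyclic_sign:
  fixes \<epsilon> :: "nat \<Rightarrow> real"
  assumes "0 < m" "\<And>k. k < m \<Longrightarrow> \<epsilon> k * \<epsilon> k = 1"
  shows "(\<Prod>j<m. \<epsilon> j * \<epsilon> (Suc j mod m)) = 1"
proof -
  obtain n where m: "m = Suc n" using assms(1) gr0_conv_Suc by blast
  have "(\<Prod>j<m. \<epsilon> j * \<epsilon> (Suc j mod m)) = (\<Prod>k<n. \<epsilon> k * \<epsilon> (Suc k)) * (\<epsilon> n * \<epsilon> 0)"
    unfolding m using prod_cyclic_split[of "\<lambda>j k. \<epsilon> j * \<epsilon> k" n] by simp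
  also have "\<dots> = (\<epsilon> 0 * \<epsilon> 0) * (\<epsilon> n * \<epsilon> n)"
    using assms prod_telescope_sign[of n \<epsilon>] by (simp add: m mult_ac)
  finally show ?thesis using assms(2)[of 0] assms(2)[of n] by (simp add: m)
qed

text \<open>The sufficiency half: with \<open>\<epsilon> k\<close> the product of the first
  \<open>k\<close> edge signs, every edge but the closing one is right by construction, and the
  total product \<open>1\<close> settles that one.\<close>

lemma cycle_switching:
  fixes s :: "nat \<Rightarrow> nat \<Rightarrow> real"
  assumes "0 < m" "\<And>j l. s j l * s j l = 1"
    and "(\<Prod>j<m. s j (Suc j mod m)) = 1"
  obtains \<epsilon> :: "nat \<Rightarrow> real" where "\<And>k. \<epsilon> k * \<epsilon> k = 1"
    "\<And>j. j < m \<Longrightarrow> \<epsilon> j * \<epsilon> (Suc j mod m) = s j (Suc j mod m)"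
proof
  define \<epsilon> where "\<epsilon> k = (\<Prod>j<k. s j (Suc j))" for k
  obtain n where m: "m = Suc n" using assms(1) gr0_conv_Suc by blast
  show sq: "\<epsilon> k * \<epsilon> k = 1" for k
    unfolding \<epsilon>_def prod.distrib[symmetric] using assms(2) by simp
  have last: "\<epsilon> n * s n 0 = 1"
    using assms(3) unfolding \<epsilon>_def m by (subst (asm) prod_cyclic_split)
  fix j assume j: "j < m"
  show "\<epsilon> j * \<epsilon> (Suc j mod m) = s j (Suc j mod m)"
  proof (cases "j = n")
    case True
    have "\<epsilon> n = \<epsilon> n * (s n 0 * s n 0)" using assms(2) by simp
    also have "\<dots> = s n 0" using last by (simp flip: mult.assoc)
    finally show ?thesis using True by (simp add: m \<epsilon>_def)
  next
    case False
    then have "Suc j mod m = Suc j" using j by (simp add: m)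
    moreover have "\<epsilon> j * \<epsilon> (Suc j) = s j (Suc j)"
      using sq[of j] by (simp add: \<epsilon>_def flip: mult.assoc)
    ultimately show ?thesis by simp
  qed
qed

text \<open>Position \<open>0\<close> of the cycle is \<open>x\<close> and position
  \<open>k + 1\<close> is \<open>p k\<close>, so the \<open>n + 1\<close> path vertices give length
  \<open>n + 2\<close>. As \<open>x\<close> meets only the two ends, it creates no chord.\<close>

lemma induced_cycle_Cons_path:
  assumes irr: "\<And>a. \<not> adj a a" and sym: "\<And>a b. adj a b \<Longrightarrow> adj b a"
    and n: "1 \<le> n" and x: "\<And>k. k \<le> n \<Longrightarrow> p k \<noteq> x"
    and inj: "\<And>j l. j < l \<Longrightarrow> l \<le> n \<Longrightarrow> p j \<noteq> p l"
    and path: "\<And>j l. j < l \<Longrightarrow> l \<le> n \<Longrightarrow> adj (p j) (p l) \<longleftrightarrow> l = Suc j"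
    and ends: "\<And>k. k \<le> n \<Longrightarrow> adj x (p k) \<longleftrightarrow> k = 0 \<or> k = n"
  shows "induced_cycle adj (Suc (Suc n)) (\<lambda>k. case k of 0 \<Rightarrow> x | Suc k \<Rightarrow> p k)"
    (is "induced_cycle adj ?m ?c")
proof -
  have lt: "adj (?c j) (?c l) \<longleftrightarrow> Suc j mod ?m = l \<or> Suc l mod ?m = j"
    if "j < l" "l < ?m" for j l
  proof -
    obtain l' where l': "l = Suc l'" using \<open>j < l\<close> by (cases l) auto
    have sl: "Suc l mod ?m = (if l' = n then 0 else Suc l)"
      using that l' by auto
    have sj: "Suc j mod ?m = Suc j" using that by simp
    show ?thesis
    proof (cases j)
      case 0
      then show ?thesis using ends[of l'] that l' sl sj by auto
    next
      case (Suc j')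
      then show ?thesis using path[of j' l'] that l' sl sj by auto
    qed
  qed
  have "?c j \<noteq> ?c l" if "j < l" "l < ?m" for j l
    using that inj x by (cases j; cases l) (auto, metis le_simps(2))
  then have "inj_on ?c {..<?m}"
    by (intro linorder_inj_onI) auto
  moreover have "adj (?c j) (?c l) \<longleftrightarrow> Suc j mod ?m = l \<or> Suc l mod ?m = j"
    if "j < ?m" "l < ?m" "j \<noteq> l" for j l
    using lt[of j l] lt[of l j] that sym by (metis linorder_neqE_nat)
  ultimately show ?thesis
    using n by (auto simp: induced_cycle_def)
qed

text \<open>A set of vertices is enlarged by one vertex \<open>x\<close> at a time. If two neighbours of \<open>x\<close> that are
  connected by a path demand different signs at \<open>x\<close>, then a shortest such path closes up through
  \<open>x\<close> to an induced cycle of sign \<open>-1\<close>.\<close>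
lemma balanced_if_induced_cycles_positive:
  fixes s :: "'b \<Rightarrow> 'b \<Rightarrow> real"
  assumes "finite T" and irr: "\<And>a. \<not> adj a a" and sym: "\<And>a b. adj a b \<Longrightarrow> adj b a"
    and s_sym: "\<And>a b. s a b = s b a" and s_sq: "\<And>a b. s a b * s a b = 1"
    and pos: "\<And>m c. induced_cycle adj m c \<Longrightarrow> c ` {..<m} \<subseteq> T \<Longrightarrow>
      (\<Prod>j<m. s (c j) (c (Suc j mod m))) = 1"
  shows "\<exists>\<epsilon> :: 'b \<Rightarrow> real. (\<forall>a. \<epsilon> a * \<epsilon> a = 1) \<and>
    (\<forall>a\<in>T. \<forall>b\<in>T. adj a b \<longrightarrow> \<epsilon> a * \<epsilon> b = s a b)"
  using assms(1) pos
proof (induction T)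
  case empty
  show ?case by (rule exI[of _ "\<lambda>_. 1"]) simp
next
  case (insert x T)
  have "\<exists>\<epsilon> :: 'b \<Rightarrow> real. (\<forall>a. \<epsilon> a * \<epsilon> a = 1) \<and>
      (\<forall>a\<in>T. \<forall>b\<in>T. adj a b \<longrightarrow> \<epsilon> a * \<epsilon> b = s a b)"
    using insert.IH insert.prems by blast
  then obtain \<epsilon> :: "'b \<Rightarrow> real" where sq: "\<And>a. \<epsilon> a * \<epsilon> a = 1"
    and \<epsilon>: "\<And>a b. a \<in> T \<Longrightarrow> b \<in> T \<Longrightarrow> adj a b \<Longrightarrow> \<epsilon> a * \<epsilon> b = s a b"
    by blast
  define R where "R = {(a, b). a \<in> T \<and> b \<in> T \<and> adj a b}"
  \<comment> \<open>The value at \<open>x\<close> that the edge to \<open>a\<close> demands if the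
    signs on \<open>T\<close> stay as in \<open>\<epsilon>\<close>.\<close>
  define t where "t a = s x a * \<epsilon> a" for a
  have t_sq: "t a * t a = 1" for a
  proof -
    have "t a * t a = (s x a * s x a) * (\<epsilon> a * \<epsilon> a)" by (simp add: t_def mult_ac)
    then show ?thesis using s_sq sq by simp
  qed
  then have t_cases: "t a = 1 \<or> t a = -1" for a
    using square_eq_1_iff[of "t a"] by simp
  define bad where "bad n \<longleftrightarrow> (\<exists>a b. a \<in> T \<and> b \<in> T \<and> adj x a \<and> adj x b \<and> t a \<noteq> t b \<and> (a, b) \<in> R ^^ n)"
    for n
  have consistent: "\<not> bad n" for n
  proof
    assume "bad n"
    \<comment> \<open>The minimum is taken over all conflicting pairs at once; this is what later
      excludes neighbours of \<open>x\<close> inside the path.\<close>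
    define N where "N = (LEAST n. bad n)"
    have "bad N" unfolding N_def using \<open>bad n\<close> by (rule LeastI)
    have min: "\<not> bad k" if "k < N" for k
      using that unfolding N_def by (rule not_less_Least)
    obtain a b where ab: "a \<in> T" "b \<in> T" "adj x a" "adj x b" "t a \<noteq> t b" "(a, b) \<in> R ^^ N"
      using \<open>bad N\<close> unfolding bad_def by blast
    obtain p where p: "p 0 = a" "p N = b" "\<And>k. k < N \<Longrightarrow> (p k, p (Suc k)) \<in> R"
      using ab(6) unfolding relpow_fun_conv by blast
    have "N \<noteq> 0" using ab(5) p(1,2) by metis
    have pT: "p k \<in> T" if "k \<le> N" for k
      using that p(3)[of k] p(2) ab(2) by (cases "k = N") (auto simp: R_def)
    have seg: "(p j, p (j + k)) \<in> R ^^ k" if "j + k \<le> N" for j k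
      unfolding relpow_fun_conv
      by (rule exI[of _ "\<lambda>l. p (j + l)"]) (use that p(3) in auto)
    have near: "t y = t z" if "k < N" "y \<in> T" "z \<in> T" "adj x y" "adj x z" "(y, z) \<in> R ^^ k" for y z k
      using min[OF that(1)] that(2-) unfolding bad_def by blast
    have no_short: "(a, b) \<notin> R ^^ k" if "k < N" for k
      using min[OF that] ab by (auto simp: bad_def)
    \<comment> \<open>Cutting out the part between two equal vertices would give a shorter walk from
      \<open>a\<close> to \<open>b\<close>; a chord, treated next, would be a shortcut in the same
      way.\<close>
    have inj: "p j \<noteq> p l" if "j < l" "l \<le> N" for j l
    proof
      assume "p j = p l"
      then have "(a, b) \<in> R ^^ j O R ^^ (N - l)"
        using seg[of 0 j] seg[of l "N - l"] that p by (auto intro: relcompI)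
      then have "(a, b) \<in> R ^^ (j + (N - l))" by (simp only: relpow_add)
      then show False
        using no_short[of "j + (N - l)"] that by fastforce
    qed
    have chord: "adj (p j) (p l) \<longleftrightarrow> l = Suc j" if "j < l" "l \<le> N" for j l
    proof
      assume "adj (p j) (p l)"
      then have "(p j, p l) \<in> R ^^ 1" using pT that by (simp add: R_def)
      then have "(a, b) \<in> R ^^ j O R ^^ 1 O R ^^ (N - l)"
        using seg[of 0 j] seg[of l "N - l"] that p by (auto intro!: relcompI)
      then have "(a, b) \<in> R ^^ (j + (1 + (N - l)))"
        by (simp only: relpow_add)
      then show "l = Suc j"
        using no_short[of "j + (1 + (N - l))"] that by fastforce
    qed (use p(3)[of j] that in \<open>auto simp: R_def\<close>)
    \<comment> \<open>An inner neighbour of \<open>x\<close> is fewer than \<open>N\<close> steps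
      from both ends, so by minimality its demand equals those of \<open>a\<close> and of
      \<open>b\<close>, which differ.\<close>
    have inner: "k = 0 \<or> k = N" if "k \<le> N" "adj x (p k)" for k
    proof (rule ccontr)
      assume "\<not> (k = 0 \<or> k = N)"
      then have k: "0 < k" "k < N" using that by auto
      have "t a = t (p k)"
        using near[OF k(2) ab(1) pT[OF that(1)] ab(3) that(2)] seg[of 0 k] that p by simp
      moreover have "t (p k) = t b"
        using near[OF _ pT[OF that(1)] ab(2) that(2) ab(4), of "N - k"] seg[of k "N - k"] that k p
        by simp
      ultimately show False using ab by simp
    qed
    define c where "c k = (case k of 0 \<Rightarrow> x | Suc k \<Rightarrow> p k)" for k
    have cyc: "induced_cycle adj (Suc (Suc N)) c"
      unfolding c_def
    proof (rule induced_cycle_Cons_path)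
      show "adj x (p k) \<longleftrightarrow> k = 0 \<or> k = N" if "k \<le> N" for k
        using inner[OF that] ab p by auto
      show "p k \<noteq> x" if "k \<le> N" for k
        using pT[OF that] insert.hyps by auto
    qed (use irr sym inj chord \<open>N \<noteq> 0\<close> in auto)
    have "c ` {..<Suc (Suc N)} \<subseteq> insert x T"
      using pT by (auto simp: c_def split: nat.splits)
    then have "(\<Prod>j<Suc (Suc N). s (c j) (c (Suc j mod Suc (Suc N)))) = 1"
      using cyc insert.prems by blast
    then have "(\<Prod>j<Suc N. s (c j) (c (Suc j))) * s (c (Suc N)) (c 0) = 1"
      using prod_cyclic_split[of "\<lambda>j k. s (c j) (c k)" "Suc N"] by simp
    moreover have "(\<Prod>j<Suc N. s (c j) (c (Suc j))) = s x a * (\<Prod>j<N. s (p j) (p (Suc j)))"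
      by (subst prod.lessThan_Suc_shift) (simp add: c_def p)
    moreover have "(\<Prod>j<N. s (p j) (p (Suc j))) = (\<Prod>j<N. \<epsilon> (p j) * \<epsilon> (p (Suc j)))"
      by (rule prod.cong) (use p(3) \<epsilon> in \<open>auto simp: R_def\<close>)
    moreover have "\<dots> = \<epsilon> a * \<epsilon> b"
      using prod_telescope_sign[of N "\<lambda>k. \<epsilon> (p k)"] sq p by simp
    \<comment> \<open>The sign of the cycle is
      \<open>s x a * (\<epsilon> a * \<epsilon> b) * s b x\<close>, the product of the two
      demands.\<close>
    ultimately have "t a * t b = 1"
      using s_sym[of b x] by (simp add: t_def c_def p mult_ac)
    then show False using ab(5) t_cases[of a] t_cases[of b] by auto
  qed
  \<comment> \<open>Flips every component of \<open>T\<close> in which some neighbour of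
    \<open>x\<close> demands \<open>-1\<close>. Afterwards all demands are \<open>1\<close>, the
    value that \<open>\<epsilon>'\<close> gives to \<open>x\<close>.\<close>
  define \<tau> where "\<tau> z = (if \<exists>y\<in>T. adj x y \<and> t y = -1 \<and> (y, z) \<in> R\<^sup>* then -1 else 1 :: real)" for z
  have \<tau>_R: "\<tau> a = \<tau> b" if "(a, b) \<in> R" for a b
  proof -
    have "(b, a) \<in> R" using that sym by (auto simp: R_def)
    then show ?thesis using that unfolding \<tau>_def by (meson rtrancl.rtrancl_into_rtrancl)
  qed
  have \<tau>_t: "\<tau> a = t a" if "a \<in> T" "adj x a" for a
  proof (cases "t a = -1")
    case True
    then show ?thesis using that by (auto simp: \<tau>_def)
  next
    case False
    then have "t a = 1" using t_cases by blast
    moreover have "\<not> (\<exists>y\<in>T. adj x y \<and> t y = -1 \<and> (y, a) \<in> R\<^sup>*)"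
    proof
      assume "\<exists>y\<in>T. adj x y \<and> t y = -1 \<and> (y, a) \<in> R\<^sup>*"
      then obtain y n where "y \<in> T" "adj x y" "t y \<noteq> t a" "(y, a) \<in> R ^^ n"
        using False by (auto simp: rtrancl_power)
      then have "bad n" unfolding bad_def using that by blast
      then show False using consistent by blast
    qed
    ultimately show ?thesis by (simp add: \<tau>_def)
  qed
  have \<tau>_sq: "\<tau> a * \<tau> a = 1" for a by (simp add: \<tau>_def)
  define \<epsilon>' where "\<epsilon>' z = (if z = x then 1 else \<epsilon> z * \<tau> z)" for z
  have "\<epsilon>' a * \<epsilon>' a = 1" for a
  proof -
    have "\<epsilon> a * \<tau> a * (\<epsilon> a * \<tau> a) = (\<epsilon> a * \<epsilon> a) * (\<tau> a * \<tau> a)" by (simp add: mult_ac)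
    then show ?thesis using sq \<tau>_sq by (simp add: \<epsilon>'_def)
  qed
  moreover have x_edge: "\<epsilon>' x * \<epsilon>' a = s x a" if "a \<in> T" "adj x a" for a
  proof -
    have "\<epsilon>' x * \<epsilon>' a = s x a * (\<epsilon> a * \<epsilon> a)"
      using that \<tau>_t insert.hyps by (auto simp: \<epsilon>'_def t_def mult_ac)
    then show ?thesis using sq by simp
  qed
  moreover have "\<epsilon>' a * \<epsilon>' b = s a b" if "a \<in> T" "b \<in> T" "adj a b" for a b
  proof -
    have "\<tau> a = \<tau> b" using that \<tau>_R by (simp add: R_def)
    then have "\<epsilon>' a * \<epsilon>' b = \<epsilon> a * \<epsilon> b * (\<tau> a * \<tau> a)"
      using that insert.hyps by (auto simp: \<epsilon>'_def mult_ac)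
    then show ?thesis using \<epsilon>[OF that] \<tau>_sq by simp
  qed
  moreover have "\<epsilon>' a * \<epsilon>' x = s a x" if "a \<in> T" "adj a x" for a
    using x_edge[OF that(1) sym[OF that(2)]] s_sym by (simp add: mult.commute)
  ultimately show ?case
    using irr by (intro exI[of _ \<epsilon>']) auto
qed

section \<open>Cochains and the adjoint of the coboundary\<close>

lemma permute_list_in_orderings:
  assumes "p permutes {..<length xs}"
  shows "permute_list p xs \<in> orderings K i \<longleftrightarrow> xs \<in> orderings K i"
  using assms by (simp add: orderings_def)

lemma cochains_iff_alternating:
  "f \<in> cochains K i \<longleftrightarrow> alternating f \<and> (\<forall>xs. xs \<notin> orderings K i \<longrightarrow> f xs = 0)"
proof
  assume f: "f \<in> cochains K i"
  then have zero: "\<And>xs. xs \<notin> orderings K i \<Longrightarrow> f xs = 0" by (simp add: cochains_def)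
  have "f (permute_list p xs) = of_int (sign p) * f xs"
    if p: "p permutes {..<length xs}" for p xs
  proof (cases "xs \<in> orderings K i")
    case True
    then show ?thesis using f p by (simp add: cochains_def)
  next
    case False
    then show ?thesis using zero permute_list_in_orderings[OF p] by simp
  qed
  then show "alternating f \<and> (\<forall>xs. xs \<notin> orderings K i \<longrightarrow> f xs = 0)"
    using zero by (simp add: alternating_def)
next
  assume "alternating f \<and> (\<forall>xs. xs \<notin> orderings K i \<longrightarrow> f xs = 0)"
  then show "f \<in> cochains K i"
    unfolding cochains_def by (auto simp: orderings_def intro!: alternating_permute)
qed

lemma some_ordering_in_orderings:
  assumes "simplicial_complex K" "F \<in> faces K i"
  shows "some_ordering F \<in> orderings K i"
  using assms some_ordering[of F] by (auto simp: orderings_def faces_def simplicial_complex_def)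

lemma Cons_in_orderings:
  assumes "simplicial_complex K" "a # xs \<in> orderings K (Suc i)"
  shows "xs \<in> orderings K i"
  using assms unfolding orderings_def faces_def simplicial_complex_def by fastforce

lemma finite_faces: "simplicial_complex K \<Longrightarrow> finite (faces K i)"
  by (simp add: simplicial_complex_def faces_def)

lemma finite_vertices: "simplicial_complex K \<Longrightarrow> finite (\<Union> K)"
  by (simp add: simplicial_complex_def)

text \<open>Positive definiteness: tested against \<open>g - h\<close> itself, the equation becomes
  a vanishing sum of nonnegative terms. This yields uniqueness of the adjoint.\<close>

lemma cochain_eqI:
  assumes K: "simplicial_complex K" and "g \<in> cochains K i" "h \<in> cochains K i"
    and w: "\<And>F. F \<in> faces K i \<Longrightarrow> 0 < w F"
    and eq: "\<And>f. f \<in> cochains K i \<Longrightarrow> cochain_inner K w i f g = cochain_inner K w i f h"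
  shows "g = h"
proof -
  define d where "d xs = g xs - h xs" for xs
  have gh: "alternating g" "alternating h" "\<And>xs. xs \<notin> orderings K i \<Longrightarrow> g xs = 0 \<and> h xs = 0"
    using assms(2,3) by (auto simp: cochains_iff_alternating)
  then have d: "alternating d"
    by (auto simp: alternating_def d_def right_diff_distrib)
  then have "d \<in> cochains K i"
    using gh by (simp add: cochains_iff_alternating d_def)
  then have "cochain_inner K w i d d = 0"
    using eq[of d] by (simp add: cochain_inner_def d_def right_diff_distrib sum_subtractf)
  then have "\<forall>F\<in>faces K i. w F * d (some_ordering F) * d (some_ordering F) = 0"
    unfolding cochain_inner_def using w finite_faces[OF K]
    by (subst (asm) sum_nonneg_eq_0_iff) (auto simp: mult.assoc less_imp_le)
  then have zero: "d (some_ordering F) = 0" if "F \<in> faces K i" for F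
    using that w[OF that] by auto
  have "d xs = 0" for xs
  proof (cases "xs \<in> orderings K i")
    case True
    then have "distinct xs" "set xs \<in> faces K i" by (auto simp: orderings_def)
    then have "d xs * d xs = d (some_ordering (set xs)) * d (some_ordering (set xs))"
      using some_ordering[of "set xs"] by (intro alternating_mult_eq d) auto
    then show ?thesis using zero[OF \<open>set xs \<in> faces K i\<close>] by simp
  qed (simp add: gh d_def)
  then show ?thesis by (auto simp: d_def)
qed

text \<open>Explicit formula for the adjoint of the coboundary. The sum may run over all vertices:
  for a cochain \<open>H\<close> the term of \<open>a\<close> vanishes unless \<open>a # xs\<close>
  is an ordering of a face.\<close>

definition divergence ::
    "'a set set \<Rightarrow> ('a set \<Rightarrow> real) \<Rightarrow> ('a list \<Rightarrow> real) \<Rightarrow> 'a list \<Rightarrow> real" where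
  "divergence K w H xs = (\<Sum>a\<in>\<Union>K. w (insert a (set xs)) * H (a # xs)) / w (set xs)"

lemma divergence_in_cochains:
  assumes K: "simplicial_complex K" and H: "H \<in> cochains K (Suc i)"
  shows "divergence K w H \<in> cochains K i"
proof -
  have alt: "alternating H" and zero: "\<And>xs. xs \<notin> orderings K (Suc i) \<Longrightarrow> H xs = 0"
    using H by (auto simp: cochains_iff_alternating)
  have "divergence K w H (permute_list p xs) = of_int (sign p) * divergence K w H xs"
    if xs: "distinct xs" and p: "p permutes {..<length xs}" for p xs
  proof -
    have "H (a # permute_list p xs) = of_int (sign p) * H (a # xs)" for a
    proof (cases "a \<in> set xs")
      case True
      then have "a # permute_list p xs \<notin> orderings K (Suc i)" "a # xs \<notin> orderings K (Suc i)"
        using p by (auto simp: orderings_def)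
      then show ?thesis using zero by simp
    next
      case False
      then show ?thesis using alternating_Cons_permute[OF alt _ p] xs by simp
    qed
    then show ?thesis
      using p by (simp add: divergence_def sum_distrib_left mult_ac)
  qed
  moreover have "divergence K w H xs = 0" if "xs \<notin> orderings K i" for xs
  proof -
    have "H (a # xs) = 0" for a
      using zero Cons_in_orderings[OF K] that by blast
    then show ?thesis by (simp add: divergence_def)
  qed
  ultimately show ?thesis
    by (simp add: cochains_iff_alternating alternating_def)
qed

text \<open>Double counting of incidences: a pair \<open>(F, x)\<close> with \<open>x\<close> in
  \<open>F\<close> corresponds to the pair \<open>(F - {x}, x)\<close>.\<close>

lemma sum_faces_incidence:
  assumes K: "simplicial_complex K"
  shows "(\<Sum>F\<in>faces K (Suc i). \<Sum>x\<in>F. \<phi> x (F - {x})) =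
    (\<Sum>G\<in>faces K i. \<Sum>a\<in>{a \<in> \<Union>K. a \<notin> G \<and> insert a G \<in> K}. \<phi> a G)"
proof -
  have fin: "finite F" if "F \<in> K" for F
    using K that by (simp add: simplicial_complex_def)
  have down: "G \<in> K" if "F \<in> K" "G \<subseteq> F" for F G
    using K that by (auto simp: simplicial_complex_def)
  have cof: "finite {a \<in> \<Union>K. a \<notin> G \<and> insert a G \<in> K}" for G
    by (rule finite_subset[OF _ finite_vertices[OF K]]) blast
  have "(\<Sum>F\<in>faces K (Suc i). \<Sum>x\<in>F. \<phi> x (F - {x})) =
      (\<Sum>(F, x)\<in>Sigma (faces K (Suc i)) (\<lambda>F. F). \<phi> x (F - {x}))"
    using finite_faces[OF K] fin by (intro sum.Sigma) (auto simp: faces_def)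
  also have "\<dots> = (\<Sum>(G, a)\<in>Sigma (faces K i) (\<lambda>G. {a \<in> \<Union>K. a \<notin> G \<and> insert a G \<in> K}). \<phi> a G)"
    by (rule sum.reindex_bij_witness[of _ "\<lambda>(G, a). (insert a G, a)" "\<lambda>(F, x). (F - {x}, x)"])
      (auto simp: faces_def insert_absorb fin intro: down)
  also have "\<dots> = (\<Sum>G\<in>faces K i. \<Sum>a\<in>{a \<in> \<Union>K. a \<notin> G \<and> insert a G \<in> K}. \<phi> a G)"
    by (intro sum.Sigma[symmetric] ballI finite_faces[OF K] cof)
  finally show ?thesis .
qed

lemma cochain_inner_coboundary:
  assumes K: "simplicial_complex K" and w: "\<And>F. F \<in> faces K i \<Longrightarrow> w F \<noteq> 0"
    and u: "u \<in> cochains K i" and H: "H \<in> cochains K (Suc i)"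
  shows "cochain_inner K w (Suc i) (coboundary K i u) H = cochain_inner K w i u (divergence K w H)"
proof -
  have alt: "alternating u" "alternating H" and zero: "\<And>xs. xs \<notin> orderings K (Suc i) \<Longrightarrow> H xs = 0"
    using u H by (auto simp: cochains_iff_alternating)
  have fin: "finite F" if "F \<in> K" for F
    using K that by (simp add: simplicial_complex_def)
  \<comment> \<open>The contribution of a single incidence. \<open>face\<close> and
    \<open>ridge\<close> write the two inner products as sums of it, grouped by the larger and by
    the smaller face.\<close>
  define \<phi> where "\<phi> x G = w (insert x G) * (u (some_ordering G) * H (x # some_ordering G))" for x G
  have face: "w F * coboundary K i u (some_ordering F) * H (some_ordering F) = (\<Sum>x\<in>F. \<phi> x (F - {x}))"
    if F: "F \<in> faces K (Suc i)" for F
  proof -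
    let ?o = "some_ordering F"
    have "finite F" using F fin by (simp add: faces_def)
    note o = some_ordering[OF this]
    have "w F * coboundary K i u ?o * H ?o = (\<Sum>j<length ?o. w F * (u (remove_nth j ?o) * ((-1) ^ j * H ?o)))"
      using some_ordering_in_orderings[OF K F]
      by (simp add: coboundary_def sum_distrib_left sum_distrib_right mult_ac)
    also have "\<dots> = (\<Sum>j<length ?o. \<phi> (?o ! j) (F - {?o ! j}))"
    proof (rule sum.cong)
      fix j assume "j \<in> {..<length ?o}"
      then have j: "j < length ?o" by simp
      note r = set_remove_nth[OF o(1) j]
      let ?G = "F - {?o ! j}"
      have G: "finite ?G" "insert (?o ! j) ?G = F" using \<open>finite F\<close> r o by auto
      have "u (remove_nth j ?o) * ((-1) ^ j * H ?o) =
          u (remove_nth j ?o) * H (?o ! j # remove_nth j ?o)"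
        using alternating_remove_nth[OF alt(2) o(1) j] by simp
      also have "\<dots> = u (some_ordering ?G) * H (?o ! j # some_ordering ?G)"
        using r o some_ordering[OF G(1)] by (intro alternating_mult_Cons_eq alt) auto
      finally show "w F * (u (remove_nth j ?o) * ((-1) ^ j * H ?o)) = \<phi> (?o ! j) ?G"
        by (simp only: \<phi>_def G(2))
    qed simp
    also have "\<dots> = (\<Sum>x\<in>F. \<phi> x (F - {x}))"
      using bij_betw_nth[OF o(1) refl o(2)[symmetric]]
      by (rule sum.reindex_bij_betw[of _ _ _ "\<lambda>x. \<phi> x (F - {x})"])
    finally show ?thesis .
  qed
  have ridge: "(\<Sum>a\<in>{a \<in> \<Union>K. a \<notin> G \<and> insert a G \<in> K}. \<phi> a G) =
      w G * u (some_ordering G) * divergence K w H (some_ordering G)" if G: "G \<in> faces K i" for G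
  proof -
    have "finite G" using G fin by (simp add: faces_def)
    note o = some_ordering[OF this]
    have "(\<Sum>a\<in>{a \<in> \<Union>K. a \<notin> G \<and> insert a G \<in> K}. \<phi> a G) = (\<Sum>a\<in>\<Union>K. \<phi> a G)"
    proof (rule sum.mono_neutral_left)
      show "\<forall>a\<in>\<Union> K - {a \<in> \<Union> K. a \<notin> G \<and> insert a G \<in> K}. \<phi> a G = 0"
      proof
        fix a assume "a \<in> \<Union> K - {a \<in> \<Union> K. a \<notin> G \<and> insert a G \<in> K}"
        then have "a # some_ordering G \<notin> orderings K (Suc i)"
          using o by (auto simp: orderings_def faces_def)
        then show "\<phi> a G = 0" using zero by (simp add: \<phi>_def)
      qed
    qed (use finite_vertices[OF K] in auto)
    then show ?thesis
      using w[OF G] o by (simp add: \<phi>_def divergence_def sum_distrib_left sum_divide_distrib mult_ac)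
  qed
  show ?thesis
    unfolding cochain_inner_def using face ridge sum_faces_incidence[OF K, of \<phi> i] by simp
qed

text \<open>\<open>cochain_inner_coboundary\<close> shows that the divergence meets the defining
  description, \<open>cochain_eqI\<close> that nothing else does.\<close>

lemma coboundary_adjoint_eq_divergence:
  assumes K: "simplicial_complex K" and w: "\<And>F. F \<in> faces K i \<Longrightarrow> 0 < w F"
    and H: "H \<in> cochains K (Suc i)"
  shows "coboundary_adjoint K w i H = divergence K w H"
  unfolding coboundary_adjoint_def
proof (rule the_equality)
  show D: "divergence K w H \<in> cochains K i \<and> (\<forall>f\<in>cochains K i.
      cochain_inner K w (Suc i) (coboundary K i f) H = cochain_inner K w i f (divergence K w H))"
    using divergence_in_cochains[OF K H] cochain_inner_coboundary[OF K _ _ H] w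
    by (metis less_irrefl)
  fix h assume "h \<in> cochains K i \<and> (\<forall>f\<in>cochains K i.
      cochain_inner K w (Suc i) (coboundary K i f) H = cochain_inner K w i f h)"
  with D show "h = divergence K w H"
    by (intro cochain_eqI[OF K _ _ w]) auto
qed

section \<open>Positivity of the normalized weights\<close>

lemma normalized_weight_pos:
  assumes "simplicial_complex K"
  shows "0 < normalized_weight K F"
  using assms
proof (induction K F rule: normalized_weight.induct)
  case (1 K F)
  show ?case
  proof (cases "F \<in> K \<and> \<not> facet K F")
    case True
    \<comment> \<open>A face that is not a facet extends by a single vertex of a larger face, so the
      sum of weights is not empty.\<close>
    then obtain G where G: "G \<in> K" "F \<subset> G" by (auto simp: facet_def)
    then obtain x where x: "x \<in> G" "x \<notin> F" by auto
    have K: "finite K" "insert x F \<in> K" "finite F"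
      using 1(2) G x True by (auto simp: simplicial_complex_def)
    then have "insert x F \<in> {G \<in> K. F \<subset> G \<and> card G = Suc (card F)}"
      using x by auto
    then have "0 < (\<Sum>G\<in>{G \<in> K. F \<subset> G \<and> card G = Suc (card F)}. normalized_weight K G)"
      using 1 True K by (intro sum_pos) auto
    then show ?thesis
      using True K by (subst normalized_weight.simps) simp
  qed (subst normalized_weight.simps; auto)
qed

section \<open>Circuits and the signs of adjacent faces\<close>

text \<open>Equals \<open>1\<close> if faces \<open>F\<close> and \<open>G\<close> with a common ridge, oriented by \<^const>\<open>ordering_sign\<close>, induce
  the same orientation on it, and \<open>-1\<close> otherwise.\<close>
definition relative_sign :: "'a set \<Rightarrow> 'a set \<Rightarrow> real" where
  "relative_sign F G = ordering_sign (the_elem (F - G) # some_ordering (F \<inter> G)) *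
     ordering_sign (the_elem (G - F) # some_ordering (F \<inter> G))"

lemma relative_sign_commute: "relative_sign F G = relative_sign G F"
  by (simp add: relative_sign_def Int_commute mult.commute)

lemma relative_sign_square [simp]: "relative_sign F G * relative_sign F G = 1"
proof -
  have "x * y * (x * y) = (x * x) * (y * y)" for x y :: real by simp
  then show ?thesis by (simp only: relative_sign_def ordering_sign_square mult_1)
qed

text \<open>Frees \<open>relative_sign\<close> from the chosen ordering of the ridge: reordering
  changes both factors by the same sign.\<close>

lemma relative_sign_Cons:
  assumes "distinct zs" "a \<notin> set zs" "b \<notin> set zs" "a \<noteq> b"
  shows "relative_sign (insert a (set zs)) (insert b (set zs)) =
    ordering_sign (a # zs) * ordering_sign (b # zs)"
proof -
  have "insert a (set zs) - insert b (set zs) = {a}" "insert b (set zs) - insert a (set zs) = {b}"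
    "insert a (set zs) \<inter> insert b (set zs) = set zs"
    using assms by auto
  then show ?thesis
    unfolding relative_sign_def using assms some_ordering[of "set zs"]
    by (auto intro!: alternating_Cons_mult_Cons_eq alternating_ordering_sign)
qed

text \<open>Mentions no complex: two faces of a complex always intersect in a face, so only the size
  of the intersection has to be prescribed.\<close>

definition adjacent :: "nat \<Rightarrow> 'a set \<Rightarrow> 'a set \<Rightarrow> bool" where
  "adjacent i F G \<longleftrightarrow> F \<noteq> G \<and> card (F \<inter> G) = Suc i"

lemma adjacent_cases:
  assumes "adjacent i F G" "card F = Suc (Suc i)" "card G = Suc (Suc i)"
  obtains a b zs where "distinct zs" "a \<notin> set zs" "b \<notin> set zs" "a \<noteq> b"
    "F = insert a (set zs)" "G = insert b (set zs)" "set zs = F \<inter> G"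
proof -
  have fin: "finite F" "finite G" using assms card.infinite by fastforce+
  obtain zs where zs: "distinct zs" "set zs = F \<inter> G"
    using finite_distinct_list[of "F \<inter> G"] fin by auto
  have "card (F - G) = 1" "card (G - F) = 1"
    using assms fin by (simp_all add: card_Diff_subset_Int adjacent_def Int_commute)
  then obtain a b where "F - G = {a}" "G - F = {b}" by (meson card_1_singletonE)
  then have "a \<notin> set zs" "b \<notin> set zs" "a \<noteq> b" "F = insert a (set zs)" "G = insert b (set zs)"
    using zs by auto
  then show ?thesis using that zs by blast
qed

section \<open>Induced orientations and orientability in terms of signs\<close>

text \<open>Putting the omitted vertex \<open>a\<close> in front turns the position sign and the
  permutation sign together into one product of ordering signs.\<close>

lemma induced_orientation_eq:
  assumes ys: "distinct ys" "set ys = insert a H" "a \<notin> H"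
  shows "induced_orientation ys H =
    {(e, zs) | e zs. distinct zs \<and> set zs = H \<and> of_int e = ordering_sign ys * ordering_sign (a # zs)}"
    (is "_ = ?R")
proof (intro subset_antisym subrelI)
  have sign_remove: "of_int ((-1) ^ j * sign p) =
      ordering_sign ys * ordering_sign (a # permute_list p (remove_nth j ys))"
    if j: "j < length ys" "ys ! j = a" and p: "p permutes {..<length (remove_nth j ys)}" for j p
  proof -
    note r = set_remove_nth[OF ys(1) j(1)]
    have "ordering_sign (a # permute_list p (remove_nth j ys)) =
        of_int (sign p) * ((-1) ^ j * ordering_sign ys)"
      using r p j alternating_Cons_permute[OF alternating_ordering_sign, of a "remove_nth j ys" p]
        alternating_remove_nth[OF alternating_ordering_sign ys(1) j(1)] by simp
    then show ?thesis by simp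
  qed
  have pos: "ys ! j = a" if "j < length ys" "set (remove_nth j ys) = H" for j
    using set_remove_nth[OF ys(1) that(1)] that(2) ys by auto
  fix e zs
  {
    assume "(e, zs) \<in> induced_orientation ys H"
    then obtain j p where j: "j < length ys" "set (remove_nth j ys) = H"
      "p permutes {..<length (remove_nth j ys)}" "e = (-1) ^ j * sign p"
      "zs = permute_list p (remove_nth j ys)"
      by (auto simp: induced_orientation_def)
    show "(e, zs) \<in> ?R"
      using sign_remove[OF j(1) pos[OF j(1,2)] j(3)] j set_remove_nth[OF ys(1) j(1)] by simp
  }
  assume "(e, zs) \<in> ?R"
  then have zs: "distinct zs" "set zs = H" and e: "of_int e = ordering_sign ys * ordering_sign (a # zs)"
    by auto
  obtain j where j: "j < length ys" "ys ! j = a"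
    using ys(2) by (metis in_set_conv_nth insertI1)
  note r = set_remove_nth[OF ys(1) j(1)]
  have H: "set (remove_nth j ys) = H" using r(1) j(2) ys by auto
  obtain p where p: "p permutes {..<length (remove_nth j ys)}" "permute_list p (remove_nth j ys) = zs"
    using obtain_permutation[OF r(2) zs(1)] H zs(2) by auto
  have "(of_int e :: real) = of_int ((-1) ^ j * sign p)"
    unfolding e sign_remove[OF j p(1)] p(2) ..
  then have "e = (-1) ^ j * sign p" by (simp only: of_int_eq_iff)
  then show "(e, zs) \<in> induced_orientation ys H"
    using j H p unfolding induced_orientation_def by blast
qed

lemma mult_sign_cancel:
  fixes x y c d :: real
  assumes "x * x = 1" "y * y = 1" "c * c = 1" "d * d = 1"
  shows "x * c = y * d \<longleftrightarrow> x * y = c * d"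
proof -
  have "x = 1 \<or> x = -1" "y = 1 \<or> y = -1" "c = 1 \<or> c = -1" "d = 1 \<or> d = -1"
    using assms square_eq_1_iff by blast+
  then show ?thesis by auto
qed

lemma mult_sign_neq:
  fixes x y c :: real
  assumes "x * x = 1" "y * y = 1" "c * c = 1"
  shows "x * y \<noteq> c \<longleftrightarrow> x * y = - c"
proof -
  have "x = 1 \<or> x = -1" "y = 1 \<or> y = -1" "c = 1 \<or> c = -1"
    using assms square_eq_1_iff by blast+
  then show ?thesis by auto
qed

text \<open>Comparing the classes on one ordering \<open>zs\<close> of the ridge decides their
  equality, because the signs of \<open>a # us\<close> and \<open>b # us\<close> multiply to
  \<open>relative_sign\<close> for every ordering \<open>us\<close>.\<close>

lemma induced_orientation_neq_iff:
  assumes adj: "adjacent i (set xs) (set ys)"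
    and "card (set xs) = Suc (Suc i)" "card (set ys) = Suc (Suc i)" "distinct xs" "distinct ys"
  shows "induced_orientation xs (set xs \<inter> set ys) \<noteq> induced_orientation ys (set xs \<inter> set ys) \<longleftrightarrow>
    ordering_sign xs * ordering_sign ys = - relative_sign (set xs) (set ys)"
proof -
  obtain a b zs where z: "distinct zs" "a \<notin> set zs" "b \<notin> set zs" "a \<noteq> b"
    "set xs = insert a (set zs)" "set ys = insert b (set zs)" "set zs = set xs \<inter> set ys"
    using adjacent_cases[OF assms(1-3)] .
  note io_xs = induced_orientation_eq[OF assms(4) z(5) z(2)]
  note io_ys = induced_orientation_eq[OF assms(5) z(6) z(3)]
  have int_ex: "\<exists>e. of_int e = ordering_sign ws * ordering_sign us" for ws us :: "'a list"
    unfolding ordering_sign_def of_int_mult[symmetric] by (rule exI, rule refl)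
  have key: "ordering_sign xs * ordering_sign (a # us) = ordering_sign ys * ordering_sign (b # us) \<longleftrightarrow>
      ordering_sign xs * ordering_sign ys = relative_sign (set xs) (set ys)"
    if us: "distinct us" "set us = set zs" for us
  proof -
    have "relative_sign (set xs) (set ys) = ordering_sign (a # us) * ordering_sign (b # us)"
      using relative_sign_Cons[of us a b] us z(2-4) unfolding z(5,6) us(2) by simp
    then show ?thesis
      using mult_sign_cancel[of "ordering_sign xs" "ordering_sign ys" "ordering_sign (a # us)"] by simp
  qed
  have "induced_orientation xs (set zs) = induced_orientation ys (set zs) \<longleftrightarrow>
      ordering_sign xs * ordering_sign ys = relative_sign (set xs) (set ys)"
  proof
    assume eq: "induced_orientation xs (set zs) = induced_orientation ys (set zs)"
    obtain e where e: "of_int e = ordering_sign xs * ordering_sign (a # zs)"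
      using int_ex by blast
    then have "(e, zs) \<in> induced_orientation xs (set zs)"
      unfolding io_xs using z(1) by simp
    then have "(e, zs) \<in> induced_orientation ys (set zs)" using eq by simp
    then have "of_int e = ordering_sign ys * ordering_sign (b # zs)"
      unfolding io_ys by simp
    then show "ordering_sign xs * ordering_sign ys = relative_sign (set xs) (set ys)"
      using e key[OF z(1) refl] by metis
  next
    assume "ordering_sign xs * ordering_sign ys = relative_sign (set xs) (set ys)"
    then show "induced_orientation xs (set zs) = induced_orientation ys (set zs)"
      unfolding io_xs io_ys using key by auto
  qed
  then show ?thesis
    unfolding z(7)[symmetric]
    using mult_sign_neq[of "ordering_sign xs" "ordering_sign ys" "relative_sign (set xs) (set ys)"]
    by simp
qed

text \<open>Here \<open>\<eta> F\<close> is the sign of the chosen ordering of \<open>F\<close>. The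
  assumption makes sharing an \<open>i\<close>-face the same as being
  \<open>adjacent\<close>.\<close>

lemma orientable_iff:
  assumes "\<And>F G. F \<in> faces L (Suc i) \<Longrightarrow> G \<in> faces L (Suc i) \<Longrightarrow> F \<inter> G \<in> L"
  shows "orientable i L \<longleftrightarrow> (\<exists>\<eta> :: 'a set \<Rightarrow> real. (\<forall>F. \<eta> F * \<eta> F = 1) \<and>
    (\<forall>F\<in>faces L (Suc i). \<forall>G\<in>faces L (Suc i). adjacent i F G \<longrightarrow> \<eta> F * \<eta> G = - relative_sign F G))"
proof -
  have adj: "F \<noteq> G \<and> F \<inter> G \<in> faces L i \<longleftrightarrow> adjacent i F G"
    if "F \<in> faces L (Suc i)" "G \<in> faces L (Suc i)" for F G
    using assms[OF that] by (auto simp: adjacent_def faces_def)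
  have neq: "induced_orientation (ori F) (F \<inter> G) \<noteq> induced_orientation (ori G) (F \<inter> G) \<longleftrightarrow>
      ordering_sign (ori F) * ordering_sign (ori G) = - relative_sign F G"
    if "\<forall>F\<in>faces L (Suc i). distinct (ori F) \<and> set (ori F) = F"
      "F \<in> faces L (Suc i)" "G \<in> faces L (Suc i)" "adjacent i F G" for ori F G
    using that induced_orientation_neq_iff[of i "ori F" "ori G"] by (auto simp: faces_def)
  show ?thesis
  proof
    assume "orientable i L"
    then obtain ori :: "'a set \<Rightarrow> 'a list" where
      ori: "\<forall>F\<in>faces L (Suc i). distinct (ori F) \<and> set (ori F) = F"
      "\<forall>F\<in>faces L (Suc i). \<forall>G\<in>faces L (Suc i). F \<noteq> G \<and> F \<inter> G \<in> faces L i \<longrightarrow>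
        induced_orientation (ori F) (F \<inter> G) \<noteq> induced_orientation (ori G) (F \<inter> G)"
      unfolding orientable_def by blast
    show "\<exists>\<eta> :: 'a set \<Rightarrow> real. (\<forall>F. \<eta> F * \<eta> F = 1) \<and>
      (\<forall>F\<in>faces L (Suc i). \<forall>G\<in>faces L (Suc i). adjacent i F G \<longrightarrow> \<eta> F * \<eta> G = - relative_sign F G)"
      using ori(2) adj neq[OF ori(1)] by (intro exI[of _ "\<lambda>F. ordering_sign (ori F)"]) auto
  next
    assume "\<exists>\<eta> :: 'a set \<Rightarrow> real. (\<forall>F. \<eta> F * \<eta> F = 1) \<and>
      (\<forall>F\<in>faces L (Suc i). \<forall>G\<in>faces L (Suc i). adjacent i F G \<longrightarrow> \<eta> F * \<eta> G = - relative_sign F G)"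
    then obtain \<eta> :: "'a set \<Rightarrow> real" where \<eta>: "\<And>F. \<eta> F * \<eta> F = 1"
      "\<And>F G. F \<in> faces L (Suc i) \<Longrightarrow> G \<in> faces L (Suc i) \<Longrightarrow> adjacent i F G \<Longrightarrow>
        \<eta> F * \<eta> G = - relative_sign F G"
      by blast
    have "\<exists>ys. distinct ys \<and> set ys = F \<and> ordering_sign ys = \<eta> F" if "F \<in> faces L (Suc i)" for F
    proof -
      have F: "card F = Suc (Suc i)" using that by (simp add: faces_def)
      then have "finite F" using card.infinite by fastforce
      then obtain xs where xs: "distinct xs" "set xs = F"
        using finite_distinct_list by blast
      then have "length xs = Suc (Suc i)" using F distinct_card by fastforce
      then obtain a b zs where abz: "xs = a # b # zs" by (metis length_Suc_conv)
      \<comment> \<open>A face has \<open>i + 2\<close> vertices, hence at least two; swapping the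
        first two realizes the other sign.\<close>
      have swap: "ordering_sign (b # a # zs) = - ordering_sign xs"
        using alternating_swap[OF alternating_ordering_sign, of "[]" a b zs] xs abz by simp
      have "\<eta> F = 1 \<or> \<eta> F = -1" "ordering_sign xs = 1 \<or> ordering_sign xs = -1"
        using \<eta>(1)[of F] ordering_sign_square[of xs] square_eq_1_iff by blast+
      then have "ordering_sign xs = \<eta> F \<or> ordering_sign (b # a # zs) = \<eta> F"
        using swap by auto
      then show ?thesis
      proof
        assume "ordering_sign (b # a # zs) = \<eta> F"
        then show ?thesis using xs abz by (intro exI[of _ "b # a # zs"]) auto
      qed (use xs in auto)
    qed
    then obtain ori where ori: "\<forall>F\<in>faces L (Suc i). distinct (ori F) \<and> set (ori F) = F"
      "\<forall>F\<in>faces L (Suc i). ordering_sign (ori F) = \<eta> F"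
      by metis
    show "orientable i L"
      unfolding orientable_def using \<eta>(2) ori adj neq[OF ori(1)] by (intro exI[of _ ori]) auto
  qed
qed

text \<open>\<open>L\<close> is generated by the faces of the cycle. A subset of \<open>c j\<close>
  with \<open>i + 2\<close> elements is \<open>c j\<close> itself, so no further
  \<open>(i+1)\<close>-faces arise.\<close>

lemma circuit_of_induced_cycle:
  assumes K: "simplicial_complex K"
    and c: "induced_cycle (adjacent i) m c" "c ` {..<m} \<subseteq> faces K (Suc i)"
  defines "L \<equiv> {G. \<exists>j<m. G \<subseteq> c j}"
  shows "circuit K i L m" "faces L (Suc i) = c ` {..<m}"
proof -
  have m: "3 \<le> m" and inj: "inj_on c {..<m}"
    and adj: "\<And>j l. j < m \<Longrightarrow> l < m \<Longrightarrow> j \<noteq> l \<Longrightarrow>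
      adjacent i (c j) (c l) \<longleftrightarrow> Suc j mod m = l \<or> Suc l mod m = j"
    using c(1) by (auto simp: induced_cycle_def)
  have cK: "c j \<in> K" "card (c j) = Suc (Suc i)" if "j < m" for j
    using c(2) that by (auto simp: faces_def)
  have fin: "finite (c j)" if "j < m" for j
    using cK[OF that] card.infinite by fastforce
  have LK: "L \<subseteq> K"
    using cK(1) K unfolding L_def simplicial_complex_def by blast
  have "finite L" using LK K finite_subset by (auto simp: simplicial_complex_def)
  moreover have "{} \<in> L" using m by (auto simp: L_def intro!: exI[of _ 0])
  moreover have "\<forall>F\<in>L. finite F" using fin finite_subset by (auto simp: L_def)
  moreover have "\<forall>F\<in>L. \<forall>G\<subseteq>F. G \<in> L" unfolding L_def by blast
  ultimately have sub: "subcomplex L K"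
    using LK by (simp add: subcomplex_def simplicial_complex_def)
  have cL: "c j \<in> L" if "j < m" for j using that by (auto simp: L_def)
  show faces: "faces L (Suc i) = c ` {..<m}"
  proof
    show "faces L (Suc i) \<subseteq> c ` {..<m}"
    proof
      fix F assume "F \<in> faces L (Suc i)"
      then obtain j where "j < m" "F \<subseteq> c j" "card F = Suc (Suc i)"
        by (auto simp: faces_def L_def)
      then have "F = c j" using card_subset_eq[OF fin] cK by simp
      then show "F \<in> c ` {..<m}" using \<open>j < m\<close> by simp
    qed
  qed (use cK cL in \<open>auto simp: faces_def\<close>)
  have "pure L (Suc i)"
    unfolding pure_def faces using cL by (auto simp: facet_def L_def)
  moreover have "c j \<inter> c l \<in> faces L i \<longleftrightarrow> Suc j mod m = l \<or> Suc l mod m = j"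
    if "j < m" "l < m" "j \<noteq> l" for j l
  proof -
    have "c j \<inter> c l \<in> L" using that by (auto simp: L_def)
    moreover have "c j \<noteq> c l" using inj that by (auto simp: inj_on_def)
    ultimately show ?thesis
      using adj[OF that] by (simp add: adjacent_def faces_def)
  qed
  ultimately show "circuit K i L m"
    unfolding circuit_def faces using m sub inj by (blast intro: bij_betw_imageI)
qed

text \<open>An orientation realizes the edge signs \<open>- relative_sign\<close> by signs of faces;
  on a cycle this is possible exactly if their product is \<open>1\<close>. The \<open>m\<close>
  minus signs give \<open>(-1) ^ m\<close>.\<close>

lemma orientable_induced_cycle_iff:
  assumes K: "simplicial_complex K"
    and c: "induced_cycle (adjacent i) m c" "c ` {..<m} \<subseteq> faces K (Suc i)"
  shows "orientable i {G. \<exists>j<m. G \<subseteq> c j} \<longleftrightarrow>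
    (-1) ^ m * (\<Prod>j<m. relative_sign (c j) (c (Suc j mod m))) = 1"
proof -
  let ?L = "{G. \<exists>j<m. G \<subseteq> c j}"
  have m: "0 < m" and inj: "inj_on c {..<m}"
    and adj: "\<And>j l. j < m \<Longrightarrow> l < m \<Longrightarrow> j \<noteq> l \<Longrightarrow>
      adjacent i (c j) (c l) \<longleftrightarrow> Suc j mod m = l \<or> Suc l mod m = j"
    using c(1) by (auto simp: induced_cycle_def)
  have next_neq: "Suc j mod m \<noteq> j" "Suc j mod m < m" if "j < m" for j
  proof -
    have "3 \<le> m" using c(1) by (simp add: induced_cycle_def)
    then show "Suc j mod m \<noteq> j" "Suc j mod m < m"
      using that by (cases "Suc j = m"; auto)+
  qed
  have faces: "faces ?L (Suc i) = c ` {..<m}"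
    using circuit_of_induced_cycle[OF assms] by simp
  have prod: "(\<Prod>j<m. - relative_sign (c j) (c (Suc j mod m))) =
      (-1) ^ m * (\<Prod>j<m. relative_sign (c j) (c (Suc j mod m)))"
    by (simp add: prod_uminus)
  have "F \<inter> G \<in> ?L" if "F \<in> faces ?L (Suc i)" for F G
    using that unfolding faces_def by blast
  then have "orientable i ?L \<longleftrightarrow> (\<exists>\<eta> :: 'a set \<Rightarrow> real. (\<forall>F. \<eta> F * \<eta> F = 1) \<and>
    (\<forall>F\<in>c ` {..<m}. \<forall>G\<in>c ` {..<m}. adjacent i F G \<longrightarrow> \<eta> F * \<eta> G = - relative_sign F G))"
    using orientable_iff[of ?L i] unfolding faces by blast
  also have "\<dots> \<longleftrightarrow> (\<Prod>j<m. - relative_sign (c j) (c (Suc j mod m))) = 1"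
  proof
    assume "\<exists>\<eta> :: 'a set \<Rightarrow> real. (\<forall>F. \<eta> F * \<eta> F = 1) \<and>
      (\<forall>F\<in>c ` {..<m}. \<forall>G\<in>c ` {..<m}. adjacent i F G \<longrightarrow> \<eta> F * \<eta> G = - relative_sign F G)"
    then obtain \<eta> :: "'a set \<Rightarrow> real" where \<eta>: "\<And>F. \<eta> F * \<eta> F = 1"
      "\<And>j l. j < m \<Longrightarrow> l < m \<Longrightarrow> adjacent i (c j) (c l) \<Longrightarrow> \<eta> (c j) * \<eta> (c l) = - relative_sign (c j) (c l)"
      by auto
    have "(\<Prod>j<m. - relative_sign (c j) (c (Suc j mod m))) = (\<Prod>j<m. \<eta> (c j) * \<eta> (c (Suc j mod m)))"
    proof (intro prod.cong refl)
      fix j assume "j \<in> {..<m}"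
      then have "j < m" by simp
      then have "adjacent i (c j) (c (Suc j mod m))"
        using adj[of j "Suc j mod m"] next_neq[of j] by metis
      then show "- relative_sign (c j) (c (Suc j mod m)) = \<eta> (c j) * \<eta> (c (Suc j mod m))"
        using \<eta>(2) next_neq(2) \<open>j < m\<close> by metis
    qed
    also have "\<dots> = 1"
      using prod_cyclic_sign[OF m, of "\<lambda>j. \<eta> (c j)"] \<eta>(1) by simp
    finally show "(\<Prod>j<m. - relative_sign (c j) (c (Suc j mod m))) = 1" .
  next
    assume "(\<Prod>j<m. - relative_sign (c j) (c (Suc j mod m))) = 1"
    then obtain \<epsilon> :: "nat \<Rightarrow> real" where \<epsilon>: "\<And>k. \<epsilon> k * \<epsilon> k = 1"
      "\<And>j. j < m \<Longrightarrow> \<epsilon> j * \<epsilon> (Suc j mod m) = - relative_sign (c j) (c (Suc j mod m))"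
      using cycle_switching[OF m, of "\<lambda>j l. - relative_sign (c j) (c l)"] by auto
    have edge: "\<epsilon> j * \<epsilon> l = - relative_sign (c j) (c l)"
      if jl: "j < m" "l < m" "adjacent i (c j) (c l)" for j l
    proof -
      have "j \<noteq> l" using jl by (auto simp: adjacent_def)
      then consider "Suc j mod m = l" | "Suc l mod m = j" using adj[OF jl(1,2)] jl(3) by blast
      then show ?thesis
      proof cases
        case 2
        then show ?thesis
          using \<epsilon>(2)[OF jl(2)] by (simp add: relative_sign_commute[of "c j"] mult.commute)
      qed (use \<epsilon>(2)[OF jl(1)] in simp)
    qed
    show "\<exists>\<eta> :: 'a set \<Rightarrow> real. (\<forall>F. \<eta> F * \<eta> F = 1) \<and>
      (\<forall>F\<in>c ` {..<m}. \<forall>G\<in>c ` {..<m}. adjacent i F G \<longrightarrow> \<eta> F * \<eta> G = - relative_sign F G)"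
      \<comment> \<open>A face receives the sign of its position on the cycle, which is well defined
        as \<open>c\<close> is injective.\<close>
      using \<epsilon>(1) edge inj
      by (intro exI[of _ "\<lambda>F. \<epsilon> (the_inv_into {..<m} c F)"]) (auto simp: the_inv_into_f_f)
  qed
  finally show ?thesis unfolding prod .
qed

lemma prod_sign_cases:
  fixes f :: "nat \<Rightarrow> real"
  assumes "\<And>j. f j * f j = 1"
  shows "(\<Prod>j<m. f j) = 1 \<or> (\<Prod>j<m. f j) = -1"
  using assms square_eq_1_iff[of "\<Prod>j<m. f j"] by (simp flip: prod.distrib)

text \<open>Induced cycles of faces through \<open>v\<close> span circuits centered at
  \<open>v\<close>, for which the two hypotheses say: orientable exactly when the length is
  even.\<close>

lemma balanced_star:
  assumes K: "simplicial_complex K"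
    and odd: "\<not> (\<exists>L m. circuit K i L m \<and> v \<in> circuit_centers i L \<and> orientable i L \<and> odd m)"
    and even: "\<not> (\<exists>L m. circuit K i L m \<and> v \<in> circuit_centers i L \<and> \<not> orientable i L \<and> even m)"
  shows "\<exists>\<epsilon> :: 'a set \<Rightarrow> real. (\<forall>F. \<epsilon> F * \<epsilon> F = 1) \<and>
    (\<forall>F\<in>{F \<in> faces K (Suc i). v \<in> F}. \<forall>G\<in>{F \<in> faces K (Suc i). v \<in> F}.
      adjacent i F G \<longrightarrow> \<epsilon> F * \<epsilon> G = relative_sign F G)"
proof (rule balanced_if_induced_cycles_positive)
  let ?T = "{F \<in> faces K (Suc i). v \<in> F}"
  show "finite ?T" using finite_faces[OF K] by simp
  show "relative_sign F G = relative_sign G F" for F G :: "'a set"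
    by (rule relative_sign_commute)
  fix m c assume c: "induced_cycle (adjacent i) m c" "c ` {..<m} \<subseteq> ?T"
  then have cK: "c ` {..<m} \<subseteq> faces K (Suc i)" by auto
  let ?L = "{G. \<exists>j<m. G \<subseteq> c j}"
  let ?P = "\<Prod>j<m. relative_sign (c j) (c (Suc j mod m))"
  have L: "circuit K i ?L m" "v \<in> circuit_centers i ?L"
    using circuit_of_induced_cycle[OF K c(1) cK] c(2) by (auto simp: circuit_centers_def)
  have "orientable i ?L \<longleftrightarrow> even m" using L odd even by blast
  then have "(-1) ^ m * ?P = 1 \<longleftrightarrow> even m"
    using orientable_induced_cycle_iff[OF K c(1) cK] by simp
  moreover have "?P = 1 \<or> ?P = -1" by (rule prod_sign_cases) simp
  \<comment> \<open>For even \<open>m\<close> the equivalence gives \<open>?P = 1\<close>; for odd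
    \<open>m\<close> it excludes \<open>?P = -1\<close>.\<close>
  ultimately show "?P = 1" by (cases "even m") auto
qed (auto simp: adjacent_def Int_commute)

section \<open>Duplicating a vertex\<close>

lemma link_singleton:
  assumes K: "simplicial_complex K" and v: "{v} \<in> K"
  shows "link K {{v}} = {U. v \<notin> U \<and> insert v U \<in> K}"
proof -
  have down: "G \<in> K" if "F \<in> K" "G \<subseteq> F" for F G
    using K that unfolding simplicial_complex_def by blast
  have star: "star K {{v}} = {F \<in> K. v \<in> F}"
    by (auto simp: star_def)
  \<comment> \<open>The closure adds only the empty face, which \<open>star\<close> ignores.\<close>
  have cl_v: "closure_of_simplices K {{v}} = {{}, {v}}"
  proof
    have "subcomplex {{}, {v}} K"
      using down[OF v] by (auto simp: subcomplex_def simplicial_complex_def)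
    then show "closure_of_simplices K {{v}} \<subseteq> {{}, {v}}"
      by (auto simp: closure_of_simplices_def)
  qed (auto simp: closure_of_simplices_def subcomplex_def simplicial_complex_def)
  then have star_cl: "star K (closure_of_simplices K {{v}}) = {F \<in> K. v \<in> F}"
    by (auto simp: star_def)
  have cl_star: "closure_of_simplices K (star K {{v}}) = {G. insert v G \<in> K}"
  proof
    let ?L = "{G. insert v G \<in> K}"
    have sub: "?L \<subseteq> K" using down by blast
    then have "finite ?L" using K finite_subset unfolding simplicial_complex_def by blast
    moreover have "\<forall>F\<in>?L. \<forall>G\<subseteq>F. G \<in> ?L"
    proof (intro ballI allI impI)
      fix F G assume "F \<in> ?L" "G \<subseteq> F"
      then show "G \<in> ?L" using down[of "insert v F" "insert v G"] by auto
    qed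
    ultimately have "subcomplex ?L K"
      using sub K v by (auto simp: subcomplex_def simplicial_complex_def)
    moreover have "star K {{v}} \<subseteq> ?L" by (auto simp: star insert_absorb)
    ultimately show "closure_of_simplices K (star K {{v}}) \<subseteq> ?L"
      unfolding closure_of_simplices_def by blast
    show "?L \<subseteq> closure_of_simplices K (star K {{v}})"
    proof
      fix G assume "G \<in> ?L"
      then have G: "insert v G \<in> star K {{v}}" by (simp add: star)
      show "G \<in> closure_of_simplices K (star K {{v}})"
        unfolding closure_of_simplices_def
      proof (rule InterI)
        fix L assume "L \<in> {L. subcomplex L K \<and> star K {{v}} \<subseteq> L}"
        then have "simplicial_complex L" "insert v G \<in> L"
          using G by (auto simp: subcomplex_def)
        then show "G \<in> L" unfolding simplicial_complex_def by blast
      qed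
    qed
  qed
  show ?thesis
    unfolding link_def cl_star star_cl by (auto simp: insert_absorb)
qed

text \<open>Removing \<open>v\<close> matches the faces through \<open>v\<close> with the simplices
  of the link and lowers the dimension by one. The maximum \<open>i\<close> is attained, as the link
  is finite and nonempty.\<close>

lemma vertex_motif_cards:
  assumes K: "simplicial_complex K" and motif: "vertex_motif K i v"
  shows "\<exists>F\<in>faces K (Suc i). v \<in> F" "\<And>F. F \<in> K \<Longrightarrow> v \<in> F \<Longrightarrow> card F \<le> Suc (Suc i)"
proof -
  let ?D = "(\<lambda>F. int (card F) - 1) ` {U. v \<notin> U \<and> insert v U \<in> K}"
  have v: "{v} \<in> K" and dim: "Max ?D = int i"
    using motif link_singleton[OF K] by (auto simp: vertex_motif_def complex_dim_def)
  have fin: "finite F" if "F \<in> K" for F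
    using K that by (simp add: simplicial_complex_def)
  have "{U. v \<notin> U \<and> insert v U \<in> K} \<subseteq> (\<lambda>F. F - {v}) ` K"
    by (force intro: rev_image_eqI)
  then have finD: "finite ?D"
    using K finite_subset by (auto simp: simplicial_complex_def intro!: finite_imageI)
  have "{} \<in> {U. v \<notin> U \<and> insert v U \<in> K}" using v by simp
  then have "?D \<noteq> {}" by blast
  then have "int i \<in> ?D" using Max_in[OF finD] dim by simp
  then obtain U where U: "v \<notin> U" "insert v U \<in> K" "int (card U) - 1 = int i"
    by auto
  then have "card (insert v U) = Suc (Suc i)" using fin[OF U(2)] by simp
  then show "\<exists>F\<in>faces K (Suc i). v \<in> F" using U by (auto simp: faces_def)
  fix F assume F: "F \<in> K" "v \<in> F"
  then have "int (card (F - {v})) - 1 \<in> ?D"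
    by (intro imageI) (simp add: insert_absorb)
  then have "int (card (F - {v})) - 1 \<le> int i" using Max_ge[OF finD] dim by simp
  then show "card F \<le> Suc (Suc i)" using F fin by (simp add: card_Diff_singleton)
qed

locale duplicated_motif =
  fixes K :: "'a set set" and v v' :: 'a and i :: nat
  assumes K: "simplicial_complex K"
    and motif: "vertex_motif K i v"
    and fresh: "{v'} \<notin> K"
begin

abbreviation "K' \<equiv> duplicate_vertex K v v'"
text \<open>A symmetry of \<open>K'\<close> that exchanges the star of \<open>v\<close> with its
  copy; the cochain \<open>H\<close> below changes sign under it.\<close>

abbreviation "\<tau> \<equiv> transpose v v'"

section \<open>Faces of the duplicated complex\<close>

lemma down: "F \<in> K \<Longrightarrow> G \<subseteq> F \<Longrightarrow> G \<in> K"
  using K unfolding simplicial_complex_def by blast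

lemma fin: "F \<in> K \<Longrightarrow> finite F"
  using K by (simp add: simplicial_complex_def)

lemma fresh_notin: "F \<in> K \<Longrightarrow> v' \<notin> F"
  using down[of F "{v'}"] fresh by auto

lemma v'_neq [simp]: "v' \<noteq> v" "v \<noteq> v'"
  using motif fresh by (auto simp: vertex_motif_def)

lemma transpose_image_insert: "v \<notin> U \<Longrightarrow> v' \<notin> U \<Longrightarrow> \<tau> ` insert v U = insert v' U"
  by (auto simp: transpose_def image_iff)

lemma transpose_image_fixed: "v \<notin> U \<Longrightarrow> v' \<notin> U \<Longrightarrow> \<tau> ` U = U"
  by (auto simp: transpose_def image_iff)

lemma transpose_image_image [simp]: "\<tau> ` \<tau> ` U = U"
  by (simp add: image_image)

text \<open>Presents \<open>K'\<close> as the union of \<open>K\<close> and its mirror image, which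
  makes the invariance under \<open>\<tau>\<close> evident.\<close>

lemma duplicate_iff: "F \<in> K' \<longleftrightarrow> F \<in> K \<or> \<tau> ` F \<in> K"
proof
  assume "F \<in> K'"
  then consider "F \<in> K" | U where "F = insert v' U" "v \<notin> U" "insert v U \<in> K"
    by (auto simp: duplicate_vertex_def)
  then show "F \<in> K \<or> \<tau> ` F \<in> K"
  proof cases
    case 2
    then have "v' \<notin> U" using fresh_notin by blast
    then have "\<tau> ` F = insert v U" using 2 transpose_image_insert[of U] by (metis transpose_image_image)
    then show ?thesis using 2 by simp
  qed simp
next
  assume "F \<in> K \<or> \<tau> ` F \<in> K"
  then show "F \<in> K'"
  proof
    assume F: "\<tau> ` F \<in> K"
    then have "v \<notin> F" using fresh_notin[OF F] by (force simp: transpose_def)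
    show "F \<in> K'"
    proof (cases "v' \<in> F")
      case True
      define U where "U = F - {v'}"
      have U: "F = insert v' U" "v \<notin> U" "v' \<notin> U" using True \<open>v \<notin> F\<close> by (auto simp: U_def)
      then have "\<tau> ` F = insert v U"
        using transpose_image_insert[of U] by (metis transpose_image_image)
      then show ?thesis using F U by (auto simp: duplicate_vertex_def)
    next
      case False
      then have "\<tau> ` F = F" using \<open>v \<notin> F\<close> by (simp add: transpose_image_fixed)
      then show ?thesis using F by (simp add: duplicate_vertex_def)
    qed
  qed (simp add: duplicate_vertex_def)
qed

lemma transpose_duplicate_iff: "\<tau> ` F \<in> K' \<longleftrightarrow> F \<in> K'"
  by (auto simp: duplicate_iff)

lemma duplicate_both: "F \<in> K' \<Longrightarrow> v \<in> F \<Longrightarrow> v' \<in> F \<Longrightarrow> False"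
  using fresh_notin[of F] fresh_notin[of "\<tau> ` F"] by (force simp: duplicate_iff transpose_def)

lemma duplicate_v: "v \<in> F \<Longrightarrow> F \<in> K' \<longleftrightarrow> F \<in> K"
  using fresh_notin[of "\<tau> ` F"] by (force simp: duplicate_iff transpose_def)

lemma simplicial_duplicate: "simplicial_complex K'"
proof -
  have "K' \<subseteq> K \<union> (\<lambda>F. \<tau> ` F) ` K"
    by (force simp: duplicate_iff intro: rev_image_eqI)
  moreover have "finite K" using K by (simp add: simplicial_complex_def)
  ultimately have "finite K'" by (meson finite_UnI finite_imageI finite_subset)
  moreover have "finite F" if "F \<in> K'" for F
    using that fin finite_imageD[of \<tau> F] by (auto simp: duplicate_iff)
  moreover have "{} \<in> K'" using K by (simp add: duplicate_iff simplicial_complex_def)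
  moreover have "G \<in> K'" if "F \<in> K'" "G \<subseteq> F" for F G
    using that down image_mono[of G F \<tau>] by (auto simp: duplicate_iff)
  ultimately show ?thesis unfolding simplicial_complex_def by blast
qed

lemma duplicate_card:
  assumes "F \<in> K'" "v \<in> F \<or> v' \<in> F"
  shows "card F \<le> Suc (Suc i)"
proof (cases "v \<in> F")
  case True
  then show ?thesis using assms duplicate_v vertex_motif_cards(2)[OF K motif] by blast
next
  case False
  then have "v' \<in> F" using assms by simp
  then have "v \<in> \<tau> ` F" by (force simp: transpose_def)
  moreover from this have "\<tau> ` F \<in> K"
    using assms(1) transpose_duplicate_iff duplicate_v by blast
  ultimately have "card (\<tau> ` F) \<le> Suc (Suc i)" by (intro vertex_motif_cards(2)[OF K motif])
  then show ?thesis by (simp add: card_image)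
qed

section \<open>Weights of the faces through the two copies\<close>

lemma facet_duplicate:
  assumes "F \<in> faces K' (Suc i)" "v \<in> F \<or> v' \<in> F"
  shows "facet K' F"
  unfolding facet_def
proof (intro conjI ballI impI)
  show "F \<in> K'" using assms by (simp add: faces_def)
  fix G assume G: "G \<in> K'" "F \<subseteq> G"
  have "finite G" using G simplicial_duplicate by (simp add: simplicial_complex_def)
  moreover have "card G \<le> card F"
    using duplicate_card[of G] G assms by (auto simp: faces_def)
  ultimately show "G = F" using G card_seteq by blast
qed

lemma normalized_weight_top:
  assumes "F \<in> faces K' (Suc i)" "v \<in> F \<or> v' \<in> F"
  shows "normalized_weight K' F = 1"
  using facet_duplicate[OF assms] by (subst normalized_weight.simps) simp

text \<open>The faces just above such a ridge are facets of weight \<open>1\<close>, so the degree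
  counts them, and each arises by adding one vertex. The vertex \<open>a\<close> ensures that
  \<open>G\<close> is not a facet itself.\<close>

lemma normalized_weight_ridge:
  assumes G: "G \<in> faces K' i" "v \<in> G \<or> v' \<in> G" and a: "a \<notin> G" "insert a G \<in> K'"
  shows "normalized_weight K' G = real (card {b \<in> \<Union>K'. b \<notin> G \<and> insert b G \<in> K'})"
proof -
  let ?T = "{F \<in> K'. G \<subset> F \<and> card F = Suc (card G)}"
  have "finite K'" "finite G"
    using simplicial_duplicate G by (auto simp: simplicial_complex_def faces_def)
  have "\<not> facet K' G" using a by (auto simp: facet_def)
  then have "normalized_weight K' G = (\<Sum>F\<in>?T. normalized_weight K' F)"
    using G \<open>finite K'\<close> by (subst normalized_weight.simps) (simp add: faces_def)
  also have "\<dots> = (\<Sum>F\<in>?T. 1)"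
    using G by (intro sum.cong refl normalized_weight_top) (auto simp: faces_def)
  also have "?T = (\<lambda>b. insert b G) ` {b \<in> \<Union>K'. b \<notin> G \<and> insert b G \<in> K'}"
  proof (intro subset_antisym subsetI)
    fix F assume F: "F \<in> ?T"
    then have "finite F" using simplicial_duplicate by (simp add: simplicial_complex_def)
    then have "card (F - G) = 1"
      using F \<open>finite G\<close> by (auto simp: card_Diff_subset)
    then obtain b where "F - G = {b}" by (meson card_1_singletonE)
    then have b: "F = insert b G" "b \<notin> G" using F by auto
    then have "b \<in> {b \<in> \<Union>K'. b \<notin> G \<and> insert b G \<in> K'}" using F by auto
    then show "F \<in> (\<lambda>b. insert b G) ` {b \<in> \<Union>K'. b \<notin> G \<and> insert b G \<in> K'}"
      unfolding b(1) by (rule imageI)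
  qed (use \<open>finite G\<close> in auto)
  also have "(\<Sum>F\<in>(\<lambda>b. insert b G) ` {b \<in> \<Union>K'. b \<notin> G \<and> insert b G \<in> K'}. 1 :: real) =
      real (card {b \<in> \<Union>K'. b \<notin> G \<and> insert b G \<in> K'})"
    by (subst sum.reindex) (auto simp: inj_on_def)
  finally show ?thesis .
qed

text \<open>Source of the eigenvalue: a face through \<open>v\<close> or \<open>v'\<close> has
  \<open>i + 2\<close> ridges; the one opposite that vertex contributes \<open>0\<close> and each of
  the other \<open>i + 1\<close> contributes the value of \<open>H\<close>.\<close>

lemma eigenvalue_if_agreeing_cochain:
  assumes h: "h \<in> cochains K (Suc i)" and h_v: "\<And>ys. v \<notin> set ys \<Longrightarrow> h ys = 0"
    and h_nz: "h \<noteq> (\<lambda>_. 0)"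
    and agree: "\<And>a b xs. a # xs \<in> orderings K (Suc i) \<Longrightarrow> b # xs \<in> orderings K (Suc i) \<Longrightarrow>
      v \<in> set xs \<Longrightarrow> h (a # xs) = h (b # xs)"
  shows "real (i + 1) \<in> up_spectrum K' i"
proof -
  define H where "H ys = h ys - h (map \<tau> ys)" for ys
  have h_alt: "alternating h" and h_zero: "\<And>ys. ys \<notin> orderings K (Suc i) \<Longrightarrow> h ys = 0"
    using h by (auto simp: cochains_iff_alternating)
  have ord_K: "set ys \<in> K" if "ys \<in> orderings K (Suc i)" for ys
    using that by (simp add: orderings_def faces_def)
  have ord_v: "ys \<in> orderings K' (Suc i) \<longleftrightarrow> ys \<in> orderings K (Suc i)" if "v \<in> set ys" for ys
    using duplicate_v[OF that] by (simp add: orderings_def faces_def)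
  have ord_map: "map \<tau> ys \<in> orderings K' (Suc i) \<longleftrightarrow> ys \<in> orderings K' (Suc i)" for ys
    using transpose_duplicate_iff[of "set ys"]
    by (simp add: orderings_def faces_def distinct_map card_image)
  have v_map: "v \<in> set (map \<tau> ys) \<longleftrightarrow> v' \<in> set ys" for ys
    by (force simp: transpose_def)
  have H_nz: "ys \<in> orderings K' (Suc i) \<and> (v \<in> set ys \<or> v' \<in> set ys)" if "H ys \<noteq> 0" for ys
  proof -
    have "h ys \<noteq> 0 \<or> h (map \<tau> ys) \<noteq> 0" using that by (auto simp: H_def)
    then show ?thesis
    proof
      assume "h ys \<noteq> 0"
      then show ?thesis using h_v h_zero ord_v by blast
    next
      assume nz: "h (map \<tau> ys) \<noteq> 0"
      then have "v \<in> set (map \<tau> ys)" using h_v by blast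
      moreover have "map \<tau> ys \<in> orderings K (Suc i)" using nz h_zero by blast
      ultimately show ?thesis using ord_v ord_map v_map by blast
    qed
  qed
  have H_map: "H (map \<tau> ys) = - H ys" for ys
    by (simp add: H_def o_def)
  have H_alt: "alternating H"
    using h_alt unfolding alternating_def H_def
    by (auto simp: permute_list_map[symmetric] distinct_map right_diff_distrib)
  have H: "H \<in> cochains K' (Suc i)"
    using H_alt H_nz unfolding cochains_iff_alternating by blast
  have H_v: "H ys = h ys" if "v \<in> set ys" for ys
  proof -
    have "v' \<in> set (map \<tau> ys)" using that by (force simp: transpose_def)
    then have "h (map \<tau> ys) = 0" using h_zero ord_K fresh_notin by blast
    then show ?thesis by (simp add: H_def)
  qed
  have H_agree: "H (a # xs) = H (b # xs)"
    if ab: "a # xs \<in> orderings K' (Suc i)" "b # xs \<in> orderings K' (Suc i)"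
      and xs: "v \<in> set xs \<or> v' \<in> set xs" for a b xs
  proof -
    have *: "H (a # xs) = H (b # xs)"
      if "a # xs \<in> orderings K' (Suc i)" "b # xs \<in> orderings K' (Suc i)" "v \<in> set xs" for a b xs
      using agree[of a xs b] ord_v[of "a # xs"] ord_v[of "b # xs"] H_v[of "a # xs"] H_v[of "b # xs"] that
      by simp
    show ?thesis
    proof (cases "v \<in> set xs")
      case False
      \<comment> \<open>Ridges through \<open>v'\<close> are mirrored to ridges through
        \<open>v\<close>; the sign from \<open>H_map\<close> occurs on both sides.\<close>
      then have "H (\<tau> a # map \<tau> xs) = H (\<tau> b # map \<tau> xs)"
        using ab xs ord_map[of "a # xs"] ord_map[of "b # xs"] v_map[of xs] by (intro *) simp_all
      then show ?thesis using H_map[of "a # xs"] H_map[of "b # xs"] by simp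
    qed (use * ab in blast)
  qed
  let ?w = "normalized_weight K'" and ?f = "divergence K' (normalized_weight K') H"
  \<comment> \<open>Where \<open>H\<close> does not vanish, the face is a facet of weight
    \<open>1\<close>, so weights survive only in the denominator.\<close>
  have wH: "?w (insert a (set xs)) * H (a # xs) = H (a # xs)" for a xs
    using H_nz[of "a # xs"] normalized_weight_top[of "insert a (set xs)"]
    by (cases "H (a # xs) = 0") (auto simp: orderings_def)
  have f_eq: "?f xs = (\<Sum>a\<in>\<Union>K'. H (a # xs)) / ?w (set xs)" for xs
    unfolding divergence_def wH ..
  have f_zero: "?f xs = 0" if "v \<notin> set xs" "v' \<notin> set xs" for xs
  proof -
    have fixed: "map \<tau> xs = xs" using that by (intro map_idI) (auto simp: transpose_def)
    have "bij_betw \<tau> (\<Union>K') (\<Union>K')"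
    proof (rule bij_betw_byWitness[where f' = \<tau>])
      show "\<tau> ` \<Union> K' \<subseteq> \<Union> K'" using transpose_duplicate_iff by blast
      from this show "\<tau> ` \<Union> K' \<subseteq> \<Union> K'" .
    qed simp_all
    then have "(\<Sum>a\<in>\<Union>K'. H (a # xs)) = (\<Sum>a\<in>\<Union>K'. H (\<tau> a # xs))"
      by (rule sum.reindex_bij_betw[symmetric])
    \<comment> \<open>\<open>\<tau>\<close> fixes \<open>xs\<close> entrywise and reverses the sign
      of \<open>H\<close>, so the sum equals its own negative.\<close>
    also have "\<dots> = - (\<Sum>a\<in>\<Union>K'. H (a # xs))"
      using H_map[of "_ # xs"] fixed by (simp add: sum_negf)
    finally show ?thesis using f_eq by simp
  qed
  have f_agree: "?f xs = H (a # xs)"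
    if a: "a # xs \<in> orderings K' (Suc i)" and xs: "v \<in> set xs \<or> v' \<in> set xs" for a xs
  proof -
    let ?A = "{b \<in> \<Union>K'. b \<notin> set xs \<and> insert b (set xs) \<in> K'}"
    have xs_ord: "distinct xs" "set xs \<in> faces K' i" "a \<notin> set xs" "insert a (set xs) \<in> K'"
      using Cons_in_orderings[OF simplicial_duplicate a] a by (auto simp: orderings_def faces_def)
    have ord: "b # xs \<in> orderings K' (Suc i) \<longleftrightarrow> b \<in> ?A" for b
      using xs_ord by (auto simp: orderings_def faces_def)
    have "(\<Sum>b\<in>\<Union>K'. H (b # xs)) = (\<Sum>b\<in>?A. H (b # xs))"
      using ord H_nz finite_vertices[OF simplicial_duplicate]
      by (intro sum.mono_neutral_right) blast+
    also have "\<dots> = (\<Sum>b\<in>?A. H (a # xs))"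
      using ord a xs by (intro sum.cong refl H_agree) auto
    also have "\<dots> = real (card ?A) * H (a # xs)" by simp
    \<comment> \<open>The number of equal summands is the weight by which the divergence
      divides.\<close>
    also have "real (card ?A) = ?w (set xs)"
      using normalized_weight_ridge[OF xs_ord(2) xs xs_ord(3,4)] by simp
    finally show ?thesis
      using f_eq normalized_weight_pos[OF simplicial_duplicate, of "set xs"] by simp
  qed
  have cob: "coboundary K' i ?f = (\<lambda>ys. real (i + 1) * H ys)"
  proof
    fix ys
    show "coboundary K' i ?f ys = real (i + 1) * H ys"
    proof (cases "ys \<in> orderings K' (Suc i)")
      case False
      then show ?thesis using H_nz by (force simp: coboundary_def)
    next
      case True
      then have ys: "distinct ys" "set ys \<in> K'" "length ys = Suc (Suc i)"
        by (auto simp: orderings_def faces_def distinct_card)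
      have ord: "ys ! j # remove_nth j ys \<in> orderings K' (Suc i)" if "j < length ys" for j
        using set_remove_nth[OF ys(1) that] True by (simp add: orderings_def)
      have move: "(-1) ^ j * H (ys ! j # remove_nth j ys) = H ys" if "j < length ys" for j
        using alternating_remove_nth[OF H_alt ys(1) that]
        by (simp flip: mult.assoc power_add mult_2)
      have eq: "coboundary K' i ?f ys = (\<Sum>j<length ys. (-1) ^ j * ?f (remove_nth j ys))"
        using True by (simp add: coboundary_def)
      show ?thesis
      proof (cases "v \<in> set ys \<or> v' \<in> set ys")
        case False
        then have "?f (remove_nth j ys) = 0" if "j < length ys" for j
          using set_remove_nth(1)[OF ys(1) that] by (intro f_zero) auto
        moreover have "H ys = 0" using False H_nz by blast
        ultimately show ?thesis unfolding eq by simp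
      next
        case True
        then obtain x where x: "x \<in> set ys" "x = v \<or> x = v'" by blast
        then obtain k where k: "k < length ys" "ys ! k = x" by (metis in_set_conv_nth)
        have only: "y = x" if "y \<in> set ys" "y = v \<or> y = v'" for y
          using that x duplicate_both[OF ys(2)] by blast
        \<comment> \<open>No face contains both \<open>v\<close> and \<open>v'\<close>, so the ridge
          opposite \<open>x\<close> contains neither.\<close>
        have "?f (remove_nth k ys) = 0"
          using set_remove_nth(1)[OF ys(1) k(1)] only k by (intro f_zero) auto
        moreover have "(-1) ^ j * ?f (remove_nth j ys) = H ys" if j: "j < length ys" "j \<noteq> k" for j
        proof -
          have "ys ! j \<noteq> x" using j k ys(1) by (auto simp: nth_eq_iff_index_eq)
          then have "x \<in> set (remove_nth j ys)" using set_remove_nth(1)[OF ys(1) j(1)] x by simp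
          then have "?f (remove_nth j ys) = H (ys ! j # remove_nth j ys)"
            using x by (intro f_agree ord j) auto
          then show ?thesis using move[OF j(1)] by simp
        qed
        ultimately have "(\<Sum>j<length ys. (-1) ^ j * ?f (remove_nth j ys)) =
            (\<Sum>j\<in>{..<length ys} - {k}. H ys)"
          using k by (subst sum.remove[of _ k]) auto
        also have "\<dots> = real (i + 1) * H ys" using k ys(3) by (simp add: card_Diff_singleton)
        finally show ?thesis unfolding eq .
      qed
    qed
  qed
  have pos: "0 < ?w F" for F by (rule normalized_weight_pos[OF simplicial_duplicate])
  have scaled: "(\<lambda>ys. real (i + 1) * H ys) \<in> cochains K' (Suc i)"
    using H_alt H unfolding cochains_iff_alternating alternating_def by (auto simp: mult_ac)
  have "normalized_up_laplacian K' i ?f = divergence K' ?w (\<lambda>ys. real (i + 1) * H ys)"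
    unfolding normalized_up_laplacian_def up_laplacian_def cob
    by (rule coboundary_adjoint_eq_divergence[OF simplicial_duplicate pos scaled])
  also have "\<dots> = (\<lambda>xs. real (i + 1) * ?f xs)"
    by (simp add: fun_eq_iff divergence_def sum_distrib_left mult_ac del: of_nat_add of_nat_Suc)
  finally have "normalized_up_laplacian K' i ?f = (\<lambda>xs. real (i + 1) * ?f xs)" .
  moreover have "?f \<in> cochains K' i"
    by (rule divergence_in_cochains[OF simplicial_duplicate H])
  moreover have "?f \<noteq> (\<lambda>_. 0)"
  proof
    assume "?f = (\<lambda>_. 0)"
    \<comment> \<open>By \<open>cob\<close> this forces \<open>H\<close> to vanish, although
      \<open>H\<close> coincides with \<open>h\<close> on lists through \<open>v\<close>.\<close>
    then have "coboundary K' i ?f = (\<lambda>_. 0)" by (simp add: coboundary_def fun_eq_iff)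
    then have "H ys = 0" for ys using fun_cong[OF cob, of ys] by simp
    then have "h ys = 0" for ys using H_v[of ys] h_v[of ys] by metis
    then show False using h_nz by blast
  qed
  ultimately show ?thesis unfolding up_spectrum_def by blast
qed

end

theorem corollary7p4:
  fixes K :: "'a set set" and v v' :: 'a and i :: nat
  assumes "simplicial_complex K"
    and "vertex_motif K i v"
    and "\<not> (\<exists>L m. circuit K i L m \<and> v \<in> circuit_centers i L \<and> orientable i L \<and> odd m)"
    and "\<not> (\<exists>L m. circuit K i L m \<and> v \<in> circuit_centers i L \<and> \<not> orientable i L \<and> even m)"
    and "{v'} \<notin> K"
  shows "real (i + 1) \<in> up_spectrum (duplicate_vertex K v v') i"
proof -
  interpret duplicated_motif K v v' i
    using assms by unfold_locales
  obtain \<epsilon> :: "'a set \<Rightarrow> real" where sq: "\<And>F. \<epsilon> F * \<epsilon> F = 1"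
    and \<epsilon>: "\<And>F G. F \<in> faces K (Suc i) \<Longrightarrow> G \<in> faces K (Suc i) \<Longrightarrow> v \<in> F \<Longrightarrow> v \<in> G \<Longrightarrow>
      adjacent i F G \<Longrightarrow> \<epsilon> F * \<epsilon> G = relative_sign F G"
    using balanced_star[OF assms(1,3,4)] by auto
  \<comment> \<open>The reference orientations of the faces through \<open>v\<close>, reversed where
    \<open>\<epsilon>\<close> is \<open>-1\<close>, read as a cochain.\<close>
  define h where "h ys = (if ys \<in> orderings K (Suc i) \<and> v \<in> set ys
    then \<epsilon> (set ys) * ordering_sign ys else 0)" for ys
  show ?thesis
  proof (rule eigenvalue_if_agreeing_cochain)
    have "alternating h"
      unfolding alternating_def
    proof (intro allI impI)
      fix xs :: "'a list" and p
      assume xs: "distinct xs" and p: "p permutes {..<length xs}"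
      then show "h (permute_list p xs) = of_int (sign p) * h xs"
        using alternating_permute[OF alternating_ordering_sign xs p] permute_list_in_orderings[OF p]
        by (simp add: h_def)
    qed
    then show "h \<in> cochains K (Suc i)"
      by (simp add: cochains_iff_alternating h_def)
    show "h ys = 0" if "v \<notin> set ys" for ys using that by (simp add: h_def)
    \<comment> \<open>The motif has dimension \<open>i\<close>, so some \<open>(i+1)\<close>-face
      contains \<open>v\<close>; there \<open>h\<close> is a product of two signs.\<close>
    obtain F where F: "F \<in> faces K (Suc i)" "v \<in> F"
      using vertex_motif_cards(1)[OF assms(1,2)] by blast
    then have "finite F" using fin by (simp add: faces_def)
    then have "h (some_ordering F) = \<epsilon> F * ordering_sign (some_ordering F)"
      using F some_ordering_in_orderings[OF assms(1) F(1)] some_ordering(2)[OF \<open>finite F\<close>]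
      by (simp add: h_def)
    moreover have "x \<noteq> 0" if "x * x = 1" for x :: real using that by auto
    note this[OF sq[of F]] this[OF ordering_sign_square[of "some_ordering F"]]
    ultimately show "h \<noteq> (\<lambda>_. 0)" by auto
    fix a b xs
    assume ab: "a # xs \<in> orderings K (Suc i)" "b # xs \<in> orderings K (Suc i)" and v: "v \<in> set xs"
    show "h (a # xs) = h (b # xs)"
    proof (cases "a = b")
      case False
      let ?F = "insert a (set xs)" and ?G = "insert b (set xs)"
      have FG: "?F \<in> faces K (Suc i)" "?G \<in> faces K (Suc i)" and xs: "distinct xs" "a \<notin> set xs" "b \<notin> set xs"
        using ab by (auto simp: orderings_def)
      have "?F \<inter> ?G = set xs" using False xs by auto
      then have "adjacent i ?F ?G"
        using FG(1) xs False by (auto simp: adjacent_def faces_def)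
      then have "\<epsilon> ?F * \<epsilon> ?G = ordering_sign (a # xs) * ordering_sign (b # xs)"
        using \<epsilon>[OF FG] v relative_sign_Cons[OF xs False] by simp
      \<comment> \<open>All four factors are signs, so balance along the edge rearranges into
        equality of the two values of \<open>h\<close>.\<close>
      then have "\<epsilon> ?F * ordering_sign (a # xs) = \<epsilon> ?G * ordering_sign (b # xs)"
        using mult_sign_cancel[OF sq sq ordering_sign_square ordering_sign_square] by blast
      then show ?thesis using ab v by (simp add: h_def)
    qed simp
  qed
qed

end
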